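(* Let $n,d$ be coprime positive integers, let $a\ge 0$ be a real number, and let $CH(n,d,a)$ be the cyclic-harmonic curve with polar equation $r(\varphi)=\cos\frac{n}{d}\varphi+a$, $\varphi\in[0,2d\pi]$, regarded as an algebraic plane curve. Let $O=(0,0)$ be the origin. (A) If $a=0$ and $n\cdot d$ is odd, then: - if $d<n$, $CH(n,d,a)$ has order $n+d$, the origin $O$ is a point of multiplicity $n$, and each of the two absolute points is a point of multiplicity $d$ of the curve; - if $d>n$, $CH(n,d,a)$ has order $n+d$, the origin $O$ is a point of multiplicity $n$, and each of the two absolute points is a point of multiplicity $\frac{n+d}{2}$ of the curve. (B) In all other cases (that is, if $a\neq 0$ or $n\cdot d$ is even): - if $d<n$, $CH(n,d,a)$ has order $2(n+d)$, the origin $O$ is a point of multiplicity $2n$, and each of the two absolute points is a point of multiplicity $2d$ of the curve; - if $d>n$, $CH(n,d,a)$ has order $2(n+d)$, the origin $O$ is a point of multiplicity $2n$, and each of the two absolute points is a point of multiplicity $n+d$ of the curve.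
   Context: The locus of points $(r(\varphi)\cos\varphi,\ r(\varphi)\sin\varphi)$, where $r(\varphi)=\cos\frac{n}{d}\varphi+a$ and $\varphi\in[0,2d\pi]$ (with $\frac nd$ a positive rational number in lowest terms and $a\ge 0$), is called the cyclic-harmonic curve $CH(n,d,a)$. For $a=0$ it is called a rose (rhodonea curve). It is regarded as an algebraic curve, namely the plane algebraic curve (considered in the complex projective plane, with homogeneous coordinates $(x_0:x_1:x_2)$, $x=x_1/x_0$, $y=x_2/x_0$) given by its implicit polynomial equation, i.e. the smallest algebraic curve containing this locus. The order of the curve is the degree of that equation. The absolute points are the points $(0:1:i)$ and $(0:1:-i)$ on the line at infinity $x_0=0$. *)

theory Defs
  imports Complex_Main "HOL-Computational_Algebra.Polynomial"
begin

definition cyclic_harmonic :: "nat \<Rightarrow> nat \<Rightarrow> real \<Rightarrow> (real \<times> real) set" where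
  "cyclic_harmonic n d a =
     (\<lambda>\<phi>. let r = cos (real n / real d * \<phi>) + a in (r * cos \<phi>, r * sin \<phi>)) ` {0..2 * real d * pi}"

text \<open>
  A polynomial in \<open>x, y\<close> over the complex numbers has type \<open>complex poly poly\<close>: the outer
  variable is \<open>y\<close>, the inner one is \<open>x\<close>, so that \<open>coeff2 F i j\<close> is the coefficient of
  \<open>x\<close> to the \<open>i\<close> times \<open>y\<close> to the \<open>j\<close>.
\<close>

definition coeff2 :: "'a::zero poly poly \<Rightarrow> nat \<Rightarrow> nat \<Rightarrow> 'a" where
  "coeff2 F i j = coeff (coeff F j) i"

definition poly2 :: "'a::comm_ring_1 poly poly \<Rightarrow> 'a \<Rightarrow> 'a \<Rightarrow> 'a" where
  "poly2 F x y = poly (poly F [:y:]) x"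

text \<open>Only meaningful for \<open>F \<noteq> 0\<close>, as is the least degree below.\<close>

definition total_degree :: "'a::zero poly poly \<Rightarrow> nat" where
  "total_degree F = Max {i + j | i j. coeff2 F i j \<noteq> 0}"

definition least_degree :: "'a::zero poly poly \<Rightarrow> nat" where
  "least_degree F = (LEAST k. \<exists>i j. k = i + j \<and> coeff2 F i j \<noteq> 0)"

text \<open>
  A plane algebraic curve is given by a nonzero polynomial up to a constant factor, and the curve
  of \<open>F\<close> is contained in the curve of \<open>G\<close> (as a union of components) iff \<open>F dvd G\<close>.  Hence \<open>F\<close>
  is an equation of the smallest algebraic curve containing the set \<open>S\<close> of real points iff it is
  a nonzero generator of the ideal of all polynomials vanishing on \<open>S\<close>.  Such an \<open>F\<close> is
  unique up to a nonzero constant, and has no repeated factors.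
\<close>

definition vanishes_on :: "complex poly poly \<Rightarrow> (real \<times> real) set \<Rightarrow> bool" where
  "vanishes_on F S \<longleftrightarrow> (\<forall>(x, y)\<in>S. poly2 F (complex_of_real x) (complex_of_real y) = 0)"

definition implicit_equation :: "(real \<times> real) set \<Rightarrow> complex poly poly \<Rightarrow> bool" where
  "implicit_equation S F \<longleftrightarrow>
     F \<noteq> 0 \<and> vanishes_on F S \<and> (\<forall>G. vanishes_on G S \<longrightarrow> F dvd G)"

text \<open>
  The homogenization of \<open>F\<close>, with polynomials in two variables substituted for the homogeneous
  coordinates \<open>x\<^sub>0, x\<^sub>1, x\<^sub>2\<close>.
\<close>

definition homogenization ::
    "'a::comm_ring_1 poly poly \<Rightarrow> 'a poly poly \<Rightarrow> 'a poly poly \<Rightarrow> 'a poly poly \<Rightarrow> 'a poly poly" where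
  "homogenization F X0 X1 X2 =
     (\<Sum>j\<le>degree F. \<Sum>i\<le>degree (coeff F j).
        [:[:coeff2 F i j:]:] * X0 ^ (total_degree F - (i + j)) * X1 ^ i * X2 ^ j)"

text \<open>
  The local equation at the point \<open>(p\<^sub>0 : p\<^sub>1 : p\<^sub>2)\<close>: dehomogenize in an affine chart
  containing the point and translate the point to the origin of that chart. Here \<open>[:[:c, 1:]:]\<close>
  is \<open>x + c\<close> and \<open>[:[:c:], 1:]\<close> is \<open>y + c\<close>.
\<close>

definition local_equation ::
    "'a::field poly poly \<Rightarrow> 'a \<times> 'a \<times> 'a \<Rightarrow> 'a poly poly" where
  "local_equation F p = (case p of (p0, p1, p2) \<Rightarrow>
     if p0 \<noteq> 0 then homogenization F 1 [:[:p1 / p0, 1:]:] [:[:p2 / p0:], 1:]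
     else if p1 \<noteq> 0 then homogenization F [:[:p0 / p1, 1:]:] 1 [:[:p2 / p1:], 1:]
     else homogenization F [:[:p0 / p2, 1:]:] [:[:p1 / p2:], 1:] 1)"

definition point_multiplicity :: "'a::field poly poly \<Rightarrow> 'a \<times> 'a \<times> 'a \<Rightarrow> nat" where
  "point_multiplicity F p = least_degree (local_equation F p)"

end

theory Submission
  imports Defs
begin

text \<open>
  Let \<open>u = x + \<i>y\<close>, \<open>v = x - \<i>y\<close>, so that \<open>uv = r\<^sup>2\<close>, and let \<open>C\<^sub>d\<close> be the Chebyshev polynomial. On the
  curve, \<open>2 r\<^sup>n C\<^sub>d(r - a) = 2 r\<^sup>n cos n\<phi> = u\<^sup>n + v\<^sup>n\<close>. If \<open>a = 0\<close> and \<open>n d\<close> is odd, the left side is even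
  in \<open>r\<close> and this is already a polynomial equation in \<open>u, v\<close>; otherwise one multiplies it by its
  conjugate under \<open>r \<mapsto> -r\<close>. All degrees and multiplicities can be read off from this product.

  That the product \<open>F\<close> generates the ideal of the curve is seen on lines through the origin: put
  \<open>u = vz\<close> and divide \<open>G(vz, v)\<close>, for \<open>G\<close> in the ideal, by \<open>F(vz, v) / v\<^sup>k\<close> with the maximal \<open>k\<close> as
  polynomials in \<open>v\<close>. For all but finitely many lines the real curve has as many distinct points on the
  line as this divisor has degree, so the remainder vanishes. Hence \<open>F\<close> divides \<open>u\<^sup>A v\<^sup>B G\<close>, and \<open>F\<close> is coprime to \<open>u\<close> and \<open>v\<close>.
\<close>

section \<open>Polynomials in two variables\<close>

lemma poly2_pCons: "poly2 (pCons c P) x y = poly c x + y * poly2 P x y"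
  by (simp add: poly2_def)

lemma poly2_0 [simp]: "poly2 0 x y = 0"
  and poly2_add [simp]: "poly2 (P + Q) x y = poly2 P x y + poly2 Q x y"
  and poly2_diff [simp]: "poly2 (P - Q) x y = poly2 P x y - poly2 Q x y"
  and poly2_mult [simp]: "poly2 (P * Q) x y = poly2 P x y * poly2 Q x y"
  and poly2_power [simp]: "poly2 (P ^ k) x y = poly2 P x y ^ k"
  and poly2_smult [simp]: "poly2 (smult c P) x y = poly c x * poly2 P x y"
  and poly2_monom [simp]: "poly2 (monom c k) x y = poly c x * y ^ k"
  by (simp_all add: poly2_def poly_monom mult.commute)

lemma poly2_1 [simp]: "poly2 1 x y = 1"
  by (simp add: poly2_def)

lemma poly2_sum [simp]: "poly2 (sum f A) x y = (\<Sum>i\<in>A. poly2 (f i) x y)"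
  by (induction A rule: infinite_finite_induct) auto

lemma poly2_altdef:
  "poly2 P x y = (\<Sum>j\<le>degree P. \<Sum>i\<le>degree (coeff P j). coeff2 P i j * x ^ i * y ^ j)"
proof -
  have "poly2 P x y = (\<Sum>j\<le>degree P. poly (coeff P j) x * y ^ j)"
    by (subst poly_as_sum_of_monoms [of P, symmetric]) (simp only: poly2_sum poly2_monom)
  also have "\<dots> = (\<Sum>j\<le>degree P. \<Sum>i\<le>degree (coeff P j). coeff2 P i j * x ^ i * y ^ j)"
    by (simp add: poly_altdef coeff2_def sum_distrib_right)
  finally show ?thesis .
qed

text \<open>Restriction to a vertical line, where roots can be counted in one variable.\<close>

definition slice :: "'a::comm_ring_1 poly poly \<Rightarrow> 'a \<Rightarrow> 'a poly" where
  "slice P x = map_poly (\<lambda>c. poly c x) P"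

lemma coeff_slice [simp]: "coeff (slice P x) k = poly (coeff P k) x"
  by (simp add: slice_def coeff_map_poly)

lemma slice_pCons: "slice (pCons c P) x = pCons (poly c x) (slice P x)"
  by (rule poly_eqI) (simp add: coeff_pCons split: nat.split)

lemma slice_0 [simp]: "slice 0 x = 0"
  by (rule poly_eqI) simp

lemma poly_slice [simp]: "poly (slice P x) y = poly2 P x y"
  by (induction P) (simp_all add: slice_pCons poly2_pCons)

lemma degree_slice_le: "degree (slice P x) \<le> degree P"
  by (rule degree_le) (simp add: coeff_eq_0)

lemma slice_mult: "slice (P * Q) x = slice P x * slice Q x"
  by (rule poly_eqI) (simp add: coeff_mult poly_sum)

lemma poly_eq_if_infinite:
  fixes p q :: "'a::idom poly"
  assumes "infinite A" "\<And>x. x \<in> A \<Longrightarrow> poly p x = poly q x"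
  shows "p = q"
proof (rule ccontr)
  assume "p \<noteq> q"
  then have "finite {x. poly (p - q) x = 0}"
    by (intro poly_roots_finite) simp
  moreover have "A \<subseteq> {x. poly (p - q) x = 0}"
    using assms(2) by auto
  ultimately show False
    using assms(1) finite_subset by blast
qed

lemma infinite_nonzero_complex: "infinite (- {0 :: complex})"
  by (simp add: infinite_UNIV_char_0)

lemma poly_eq_if_nonzero:
  fixes p q :: "complex poly"
  assumes "\<And>x. x \<noteq> 0 \<Longrightarrow> poly p x = poly q x"
  shows "p = q"
  using assms by (intro poly_eq_if_infinite [OF infinite_nonzero_complex]) auto

text \<open>Leaving out the points with \<open>y = 0\<close> allows identities to be verified after
  division by \<open>y\<close>.\<close>

lemma poly2_eqI:
  fixes P Q :: "complex poly poly"
  assumes "\<And>x y. y \<noteq> 0 \<Longrightarrow> poly2 P x y = poly2 Q x y"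
  shows "P = Q"
proof -
  have "slice P x = slice Q x" for x
    using assms by (intro poly_eq_if_nonzero) simp
  then have "poly (coeff P k) x = poly (coeff Q k) x" for k x
    by (metis coeff_slice)
  then show ?thesis
    by (intro poly_eqI) (metis poly_eqI poly_eq_poly_eq_iff ext)
qed

text \<open>Polynomials are later introduced by prescribing their values. The closure rules below
  supply existence, so coefficients need not be written out.\<close>

definition polyfun2 :: "(complex \<Rightarrow> complex \<Rightarrow> complex) \<Rightarrow> bool" where
  "polyfun2 f \<longleftrightarrow> (\<exists>P. \<forall>x y. poly2 P x y = f x y)"

lemma polyfun2_const: "polyfun2 (\<lambda>x y. c)"
  and polyfun2_fst: "polyfun2 (\<lambda>x y. x)"
  and polyfun2_snd: "polyfun2 (\<lambda>x y. y)"
  unfolding polyfun2_def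
  by (rule exI [of _ "[:[:c:]:]"] exI [of _ "[:[:0, 1:]:]"] exI [of _ "[:0, 1:]"],
      simp add: poly2_def)+

lemma polyfun2_add: "polyfun2 f \<Longrightarrow> polyfun2 g \<Longrightarrow> polyfun2 (\<lambda>x y. f x y + g x y)"
  unfolding polyfun2_def by (metis poly2_add)

lemma polyfun2_diff: "polyfun2 f \<Longrightarrow> polyfun2 g \<Longrightarrow> polyfun2 (\<lambda>x y. f x y - g x y)"
  unfolding polyfun2_def by (metis poly2_diff)

lemma polyfun2_mult: "polyfun2 f \<Longrightarrow> polyfun2 g \<Longrightarrow> polyfun2 (\<lambda>x y. f x y * g x y)"
  unfolding polyfun2_def by (metis poly2_mult)

lemma polyfun2_power: "polyfun2 f \<Longrightarrow> polyfun2 (\<lambda>x y. f x y ^ k)"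
  unfolding polyfun2_def by (metis poly2_power)

lemma polyfun2_poly:
  assumes "polyfun2 f"
  shows "polyfun2 (\<lambda>x y. poly p (f x y))"
  by (induction p) (simp_all add: polyfun2_const polyfun2_add polyfun2_mult assms)

lemma polyfun2_poly2:
  assumes "polyfun2 f" "polyfun2 g"
  shows "polyfun2 (\<lambda>x y. poly2 P (f x y) (g x y))"
  by (induction P)
     (simp_all add: poly2_pCons polyfun2_const polyfun2_add polyfun2_mult polyfun2_poly assms)

lemmas polyfun2_intros = polyfun2_const polyfun2_fst polyfun2_snd polyfun2_add polyfun2_diff
  polyfun2_mult polyfun2_power polyfun2_poly polyfun2_poly2

text \<open>Substituting \<open>x y\<close> for \<open>y\<close> turns the homogeneous components of \<open>F\<close> into the coefficients of the
  powers of \<open>x\<close>, so that both degrees can be read off from one-variable polynomials.\<close>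

lemma blowup_exists:
  fixes F :: "'a::comm_ring_1 poly poly"
  obtains B where "\<And>x y. poly2 B y x = poly2 F x (x * y)"
    "\<And>k. coeff B k \<noteq> 0 \<longleftrightarrow> (\<exists>i j. k = i + j \<and> coeff2 F i j \<noteq> 0)"
proof -
  have "\<exists>B. (\<forall>x y. poly2 B y x = poly2 F x (x * y)) \<and>
    (\<forall>i j. coeff2 B j (i + j) = coeff2 F i j) \<and> (\<forall>j k. k < j \<longrightarrow> coeff2 B j k = 0)"
  proof (induction F)
    case 0
    show ?case
      by (rule exI [of _ 0]) (simp add: coeff2_def)
  next
    case (pCons c F)
    then obtain B where B: "\<And>x y. poly2 B y x = poly2 F x (x * y)"
      "\<And>i j. coeff2 B j (i + j) = coeff2 F i j" "\<And>j k. k < j \<Longrightarrow> coeff2 B j k = 0"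
      by blast
    \<comment> \<open>In \<open>B\<close> the outer variable is \<open>x\<close>: the powers of
      \<open>x\<close> in \<open>c\<close> move there, and multiplication by the old
      \<open>y\<close> becomes multiplication by \<open>x * y\<close>.\<close>
    define C where "C = map_poly (\<lambda>a. [:a:]) c + pCons 0 (smult [:0, 1:] B)"
    have 1: "poly2 (map_poly (\<lambda>a. [:a:]) c) y x = poly c x" for x y
      by (induction c) (simp_all add: poly2_pCons map_poly_pCons)
    have "poly2 C y x = poly2 (pCons c F) x (x * y)" for x y
      by (simp add: C_def 1 poly2_pCons B(1) algebra_simps)
    moreover have 2: "coeff2 C j k = (if j = 0 then coeff c k else 0) +
        (if j = 0 \<or> k = 0 then 0 else coeff2 B (j - 1) (k - 1))" for j k
      by (auto simp: C_def coeff2_def coeff_map_poly coeff_pCons split: nat.splits)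
    have "coeff2 C j (i + j) = coeff2 (pCons c F) i j" for i j
      using B(2) [of "j - 1" i] by (cases j) (simp_all add: 2, simp_all add: coeff2_def)
    moreover have "coeff2 C j k = 0" if "k < j" for j k
      using B(3) [of "k - 1" "j - 1"] that by (auto simp: 2)
    ultimately show ?case by blast
  qed
  then obtain B where B: "\<And>x y. poly2 B y x = poly2 F x (x * y)"
    "\<And>i j. coeff2 B j (i + j) = coeff2 F i j" "\<And>j k. k < j \<Longrightarrow> coeff2 B j k = 0"
    by blast
  have "coeff B k \<noteq> 0 \<longleftrightarrow> (\<exists>i j. k = i + j \<and> coeff2 F i j \<noteq> 0)" for k
  proof -
    have "coeff B k \<noteq> 0 \<longleftrightarrow> (\<exists>j. coeff2 B j k \<noteq> 0)"
      by (simp add: coeff2_def poly_eq_iff)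
    also have "\<dots> \<longleftrightarrow> (\<exists>i j. k = i + j \<and> coeff2 F i j \<noteq> 0)"
      by (metis B(2,3) le_add_diff_inverse2 not_le)
    finally show ?thesis .
  qed
  with B(1) that show ?thesis by blast
qed

lemma coeff_nonzero_iff_slice:
  fixes B :: "complex poly poly"
  shows "coeff B k \<noteq> 0 \<longleftrightarrow> (\<exists>y. coeff (slice B y) k \<noteq> 0)"
  by (simp add: poly_all_0_iff_0 flip: not_all)

text \<open>A homogeneous component may vanish on single lines, so the upper bound is required for
  every slope \<open>y\<close>; attaining it on one slope is enough.\<close>

lemma total_degree_eqI:
  fixes F :: "complex poly poly"
  assumes "\<And>y. \<exists>p. degree p \<le> D \<and> (\<forall>x. x \<noteq> 0 \<longrightarrow> poly2 F x (x * y) = poly p x)"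
    and "\<forall>x. x \<noteq> 0 \<longrightarrow> poly2 F x (x * y0) = poly p0 x" "coeff p0 D \<noteq> 0"
  shows "total_degree F = D"
proof -
  obtain B where B: "\<And>x y. poly2 B y x = poly2 F x (x * y)"
    "\<And>k. coeff B k \<noteq> 0 \<longleftrightarrow> (\<exists>i j. k = i + j \<and> coeff2 F i j \<noteq> 0)"
    using blowup_exists [of F] by metis
  have "{i + j | i j. coeff2 F i j \<noteq> 0} = {k. coeff B k \<noteq> 0}"
    by (auto simp: B(2))
  moreover have "coeff B k = 0" if "k > D" for k
  proof -
    have "coeff (slice B y) k = 0" for y
    proof -
      obtain p where p: "degree p \<le> D" "\<forall>x. x \<noteq> 0 \<longrightarrow> poly2 F x (x * y) = poly p x"
        using assms(1) by blast
      then have "slice B y = p"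
        by (intro poly_eq_if_nonzero) (simp add: B(1))
      with p(1) that show ?thesis
        by (simp add: coeff_eq_0 del: coeff_slice)
    qed
    then show ?thesis
      using coeff_nonzero_iff_slice by blast
  qed
  moreover have "coeff B D \<noteq> 0"
  proof -
    have "slice B y0 = p0"
      using assms(2) by (intro poly_eq_if_nonzero) (simp add: B(1))
    with assms(3) show ?thesis
      using coeff_nonzero_iff_slice by blast
  qed
  ultimately have "{i + j | i j. coeff2 F i j \<noteq> 0} = {k. coeff B k \<noteq> 0}"
    "{k. coeff B k \<noteq> 0} \<subseteq> {..D}" "D \<in> {k. coeff B k \<noteq> 0}"
    by (auto simp: not_le [symmetric])
  then show ?thesis
    unfolding total_degree_def by (metis (no_types, lifting) Max_eqI atMost_iff finite_atMost finite_subset subsetD)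
qed

lemma least_degree_eqI:
  fixes F :: "complex poly poly"
  assumes "\<And>y. \<exists>p. \<forall>x. x \<noteq> 0 \<longrightarrow> poly2 F x (x * y) = x ^ m * poly p x"
    and "\<forall>x. x \<noteq> 0 \<longrightarrow> poly2 F x (x * y0) = x ^ m * poly p0 x" "poly p0 0 \<noteq> 0"
  shows "least_degree F = m"
proof -
  obtain B where B: "\<And>x y. poly2 B y x = poly2 F x (x * y)"
    "\<And>k. coeff B k \<noteq> 0 \<longleftrightarrow> (\<exists>i j. k = i + j \<and> coeff2 F i j \<noteq> 0)"
    using blowup_exists [of F] by metis
  have "coeff B k = 0" if "k < m" for k
  proof -
    have "coeff (slice B y) k = 0" for y
    proof -
      obtain p where p: "\<forall>x. x \<noteq> 0 \<longrightarrow> poly2 F x (x * y) = x ^ m * poly p x"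
        using assms(1) by blast
      then have "slice B y = monom 1 m * p"
        by (intro poly_eq_if_nonzero) (simp add: B(1) poly_monom)
      with that show ?thesis
        by (simp add: coeff_monom_mult del: coeff_slice)
    qed
    then show ?thesis
      using coeff_nonzero_iff_slice by blast
  qed
  moreover have "coeff B m \<noteq> 0"
  proof -
    have "slice B y0 = monom 1 m * p0"
      using assms(2) by (intro poly_eq_if_nonzero) (simp add: B(1) poly_monom)
    with assms(3) have "coeff (slice B y0) m \<noteq> 0"
      by (simp add: coeff_monom_mult poly_0_coeff_0 del: coeff_slice)
    then show ?thesis
      using coeff_nonzero_iff_slice by blast
  qed
  ultimately show ?thesis
    unfolding least_degree_def B(2) [symmetric] by (intro Least_equality) (auto simp: not_less [symmetric])
qed

section \<open>Homogenization and local equations\<close>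

lemma coeff2_nonzero_imp_le:
  assumes "coeff2 F i j \<noteq> 0"
  shows "j \<le> degree F" "i \<le> degree (coeff F j)"
  using assms by (auto simp: coeff2_def intro!: le_degree)

lemma coeff2_nonzero_imp_le_total_degree:
  assumes "coeff2 F i j \<noteq> 0"
  shows "i + j \<le> total_degree F"
proof -
  have "{i + j | i j. coeff2 F i j \<noteq> 0} \<subseteq>
      (\<lambda>(j, i). i + j) ` (SIGMA j:{..degree F}. {..degree (coeff F j)})"
    by (force dest: coeff2_nonzero_imp_le)
  then have "finite {i + j | i j. coeff2 F i j \<noteq> 0}"
    by (rule finite_subset) auto
  with assms show ?thesis
    unfolding total_degree_def by (intro Max_ge) auto
qed

lemma poly2_homogenization:
  fixes F :: "'a::field poly poly"
  assumes "poly2 X0 x y \<noteq> 0"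
  shows "poly2 (homogenization F X0 X1 X2) x y =
    poly2 X0 x y ^ total_degree F *
      poly2 F (poly2 X1 x y / poly2 X0 x y) (poly2 X2 x y / poly2 X0 x y)"
proof -
  have const: "poly2 [:[:c:]:] x y = c" for c
    by (simp add: poly2_pCons)
  show ?thesis
    unfolding homogenization_def poly2_altdef [of F] sum_distrib_left poly2_sum
  proof (intro sum.cong refl)
    fix i j
    show "poly2 ([:[:coeff2 F i j:]:] * X0 ^ (total_degree F - (i + j)) * X1 ^ i * X2 ^ j) x y =
      poly2 X0 x y ^ total_degree F *
        (coeff2 F i j * (poly2 X1 x y / poly2 X0 x y) ^ i * (poly2 X2 x y / poly2 X0 x y) ^ j)"
    proof (cases "coeff2 F i j = 0")
      case False
      \<comment> \<open>A nonzero coefficient has \<open>i + j\<close> at most the total degree, so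
        the natural subtraction in the exponent is not truncated.\<close>
      then have "poly2 X0 x y ^ total_degree F =
          poly2 X0 x y ^ (total_degree F - (i + j)) * poly2 X0 x y ^ i * poly2 X0 x y ^ j"
        using coeff2_nonzero_imp_le_total_degree [of F i j] by (simp flip: power_add)
      with assms show ?thesis
        by (simp add: const power_divide field_simps)
    qed (simp add: const)
  qed
qed

lemma point_multiplicity_origin:
  fixes F :: "complex poly poly"
  shows "point_multiplicity F (1, 0, 0) = least_degree F"
proof -
  have "local_equation F (1, 0, 0) = F"
    by (rule poly2_eqI) (simp add: local_equation_def poly2_homogenization poly2_pCons)
  then show ?thesis
    by (simp add: point_multiplicity_def)
qed

text \<open>In the chart \<open>x1 = 1\<close> the local coordinates are \<open>x = x0 / x1\<close>
  and \<open>y = x2 / x1 - c\<close>.\<close>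

lemma poly2_local_equation_infinity:
  fixes F :: "complex poly poly"
  assumes "x \<noteq> 0"
  shows "poly2 (local_equation F (0, 1, c)) x y = x ^ total_degree F * poly2 F (1 / x) ((c + y) / x)"
  using assms by (simp add: local_equation_def poly2_homogenization poly2_pCons)

lemma total_degree_smult:
  fixes c :: "'a::field"
  shows "c \<noteq> 0 \<Longrightarrow> total_degree (smult [:c:] F) = total_degree F"
  by (simp add: total_degree_def coeff2_def)

lemma least_degree_smult:
  fixes c :: "'a::field"
  shows "c \<noteq> 0 \<Longrightarrow> least_degree (smult [:c:] F) = least_degree F"
  by (simp add: least_degree_def coeff2_def)

section \<open>Top coefficients of products, cancellation of coordinate factors\<close>

lemma coeff_mult_top:
  assumes "degree p \<le> a" "degree q \<le> b"
  shows "coeff (p * q) (a + b) = coeff p a * coeff q b"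
proof -
  have "coeff p i * coeff q (a + b - i) = 0" if "i \<noteq> a" for i
    using that assms by (cases "i < a") (auto simp: coeff_eq_0)
  then have "(\<Sum>i\<le>a + b. coeff p i * coeff q (a + b - i)) =
      (\<Sum>i\<in>{a}. coeff p i * coeff q (a + b - i))"
    by (intro sum.mono_neutral_right) auto
  then show ?thesis
    by (simp add: coeff_mult)
qed

text \<open>Working with a degree bound keeps the formula valid on special lines where the top
  coefficient vanishes.\<close>

lemma degree_coeff_prod:
  assumes "finite A" "\<And>i. i \<in> A \<Longrightarrow> degree (f i) \<le> b"
  shows "degree (prod f A) \<le> card A * b \<and> coeff (prod f A) (card A * b) = (\<Prod>i\<in>A. coeff (f i) b)"
  using assms
proof (induction A)
  case (insert i A)
  then have "degree (f i * prod f A) \<le> b + card A * b"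
    by (intro order.trans [OF degree_mult_le] add_mono) auto
  moreover have "coeff (f i * prod f A) (b + card A * b) = coeff (f i) b * (\<Prod>i\<in>A. coeff (f i) b)"
    using insert by (simp add: coeff_mult_top)
  ultimately show ?case
    using insert.hyps by simp
qed auto

lemma dvd_if_dvd_power_mult:
  fixes p x :: "'a::comm_ring_1"
  assumes "\<And>A. p dvd x * A \<Longrightarrow> p dvd A" "p dvd x ^ k * A"
  shows "p dvd A"
  using assms(2)
proof (induction k)
  case (Suc k)
  from Suc.prems have "p dvd x * (x ^ k * A)"
    by (simp only: power_Suc mult.assoc)
  then have "p dvd x ^ k * A"
    by (rule assms(1))
  then show ?case
    by (rule Suc.IH)
qed simp

text \<open>Since \<open>F\<close> does not vanish on the axis, the cofactor does.\<close>

lemma dvd_cancel_snd: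
  fixes F :: "complex poly poly"
  assumes "\<And>x. x \<noteq> 0 \<Longrightarrow> poly2 F x 0 \<noteq> 0" "F dvd [:0, 1:] * A"
  shows "F dvd A"
proof -
  obtain Q where Q: "[:0, 1:] * A = F * Q"
    using assms(2) by blast
  have "poly2 F x 0 * poly2 Q x 0 = 0" for x
    using arg_cong [OF Q, of "\<lambda>P. poly2 P x 0"] by (simp add: poly2_pCons del: mult_pCons_left)
  then have "poly2 Q x 0 = 0" if "x \<noteq> 0" for x
    using assms(1) that by auto
  then have "coeff Q 0 = 0"
    by (intro poly_eq_if_nonzero) (cases Q, simp add: poly2_pCons)
  then obtain Q' where "Q = [:0, 1:] * Q'"
    by (cases Q) auto
  with Q have "[:0, 1:] * A = [:0, 1:] * (F * Q')"
    by (simp only: ac_simps)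
  then show ?thesis
    by (subst (asm) mult_left_cancel) auto
qed

lemma dvd_cancel_fst:
  fixes F :: "complex poly poly"
  assumes "\<And>y. y \<noteq> 0 \<Longrightarrow> poly2 F 0 y \<noteq> 0" "F dvd [:[:0, 1:]:] * A"
  shows "F dvd A"
proof -
  obtain Q where Q: "[:[:0, 1:]:] * A = F * Q"
    using assms(2) by blast
  have "poly2 F 0 y * poly2 Q 0 y = 0" for y
    using arg_cong [OF Q, of "\<lambda>P. poly2 P 0 y"] by (simp add: poly2_pCons del: mult_pCons_left)
  then have "slice Q 0 = 0"
    using assms(1) by (intro poly_eq_if_nonzero) auto
  then have "poly (coeff Q k) 0 = 0" for k
    by (metis coeff_slice coeff_0)
  then have "[:[:0, 1:]:] dvd Q"
    by (auto simp: const_poly_dvd_iff poly_eq_0_iff_dvd)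
  then obtain Q' where "Q = [:[:0, 1:]:] * Q'"
    by blast
  with Q have "[:[:0, 1:]:] * A = [:[:0, 1:]:] * (F * Q')"
    by (simp only: ac_simps)
  then show ?thesis
    by (subst (asm) mult_left_cancel) auto
qed

text \<open>Meant for \<open>r ^ n * T(r)\<close>: a change of sign of the radius flips only the odd
  part, and \<open>r^2 = u * v\<close> expresses \<open>q\<close> and \<open>r\<close> through
  \<open>u, v\<close>.\<close>

lemma even_odd_parts:
  fixes p :: "'a::comm_ring_1 poly"
  shows "\<exists>q r. \<forall>x. poly p x = poly q (x\<^sup>2) + x * poly r (x\<^sup>2)"
proof (induction p)
  case 0
  show ?case
    by (rule exI [of _ 0])+ simp
next
  case (pCons a p)
  then obtain q r where "\<forall>x. poly p x = poly q (x\<^sup>2) + x * poly r (x\<^sup>2)"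
    by blast
  then have "\<forall>x. poly (pCons a p) x = poly (pCons a r) (x\<^sup>2) + x * poly q (x\<^sup>2)"
    by (simp add: algebra_simps power2_eq_square)
  then show ?case by blast
qed

text \<open>Clears denominators when passing from the blowup chart \<open>z = u / v\<close> back to \<open>u, v\<close>.\<close>

definition laurent_in_snd :: "(complex \<Rightarrow> complex \<Rightarrow> complex) \<Rightarrow> bool" where
  "laurent_in_snd f \<longleftrightarrow> (\<exists>L P. \<forall>u v. v \<noteq> 0 \<longrightarrow> v ^ L * f u v = poly2 P u v)"

lemma laurent_in_snd_add:
  assumes "laurent_in_snd f" "laurent_in_snd g"
  shows "laurent_in_snd (\<lambda>u v. f u v + g u v)"
proof -
  obtain K P L Q where *: "\<And>u v. v \<noteq> 0 \<Longrightarrow> v ^ K * f u v = poly2 P u v"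
    "\<And>u v. v \<noteq> 0 \<Longrightarrow> v ^ L * g u v = poly2 Q u v"
    using assms unfolding laurent_in_snd_def by metis
  have "v ^ (K + L) * (f u v + g u v) = poly2 ([:0, 1:] ^ L * P + [:0, 1:] ^ K * Q) u v"
    if "v \<noteq> 0" for u v
    by (simp add: poly2_pCons power_add algebra_simps flip: * [OF that])
  then show ?thesis
    unfolding laurent_in_snd_def by blast
qed

lemma laurent_in_snd_mult:
  assumes "laurent_in_snd f" "laurent_in_snd g"
  shows "laurent_in_snd (\<lambda>u v. f u v * g u v)"
proof -
  obtain K P L Q where *: "\<And>u v. v \<noteq> 0 \<Longrightarrow> v ^ K * f u v = poly2 P u v"
    "\<And>u v. v \<noteq> 0 \<Longrightarrow> v ^ L * g u v = poly2 Q u v"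
    using assms unfolding laurent_in_snd_def by metis
  have "v ^ (K + L) * (f u v * g u v) = poly2 (P * Q) u v" if "v \<noteq> 0" for u v
    by (simp add: power_add algebra_simps flip: * [OF that])
  then show ?thesis
    unfolding laurent_in_snd_def by blast
qed

lemma laurent_in_snd_polyfun2:
  assumes "polyfun2 f"
  shows "laurent_in_snd f"
proof -
  obtain P where "\<forall>u v. poly2 P u v = f u v"
    using assms unfolding polyfun2_def by blast
  then show ?thesis
    unfolding laurent_in_snd_def by (intro exI [of _ 0] exI [of _ P]) simp
qed

lemma laurent_in_snd_quotient: "laurent_in_snd (\<lambda>u v. u / v)"
  unfolding laurent_in_snd_def
  by (rule exI [of _ 1], rule exI [of _ "[:[:0, 1:]:]"]) (simp add: poly2_pCons)

lemma laurent_in_snd_poly: "laurent_in_snd (\<lambda>u v. poly p (u / v))"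
  by (induction p)
     (simp_all add: laurent_in_snd_polyfun2 polyfun2_const laurent_in_snd_add laurent_in_snd_mult
       laurent_in_snd_quotient del: times_divide_eq_left)

lemma laurent_in_snd_poly2: "laurent_in_snd (\<lambda>u v. poly2 P (u / v) v)"
  by (induction P)
     (simp_all add: poly2_pCons laurent_in_snd_polyfun2 polyfun2_intros laurent_in_snd_add
       laurent_in_snd_mult laurent_in_snd_poly)

lemma slice_monom_1 [simp]: "slice (monom 1 k) x = monom 1 k"
  by (rule poly_eqI) (simp add: coeff_monom)

text \<open>Meant for an absolute point, where one of \<open>u, v\<close> has a pole at
  \<open>x = 0\<close>. After multiplication by \<open>x ^ M\<close> only the term of degree
  \<open>M\<close> survives at \<open>0\<close>.\<close>

lemma poly_reversal:
  fixes h :: "complex poly"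
  assumes "degree h \<le> M"
  obtains p where "\<And>x. x \<noteq> 0 \<Longrightarrow> x ^ M * poly h ((b - a * x) / x) = poly p x"
    "poly p 0 = coeff h M * b ^ M"
proof
  define p where "p = (\<Sum>k\<le>M. smult (coeff h k) ([:b, - a:] ^ k * monom 1 (M - k)))"
  have h: "poly h w = (\<Sum>k\<le>M. coeff h k * w ^ k)" for w
    unfolding poly_altdef using assms by (intro sum.mono_neutral_left) (auto simp: coeff_eq_0)
  show "x ^ M * poly h ((b - a * x) / x) = poly p x" if "x \<noteq> 0" for x
  proof -
    have "x ^ M * (coeff h k * ((b - a * x) / x) ^ k) = coeff h k * ((b - a * x) ^ k * x ^ (M - k))"
      if "k \<le> M" for k
      using that \<open>x \<noteq> 0\<close> by (simp add: power_divide power_diff)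
    then show ?thesis
      unfolding p_def h poly_sum sum_distrib_left
      by (intro sum.cong refl) (simp add: poly_monom mult_ac)
  qed
  have "poly p 0 = (\<Sum>k\<le>M. if k = M then coeff h k * b ^ k else 0)"
    unfolding p_def poly_sum by (intro sum.cong) (auto simp: poly_monom)
  then show "poly p 0 = coeff h M * b ^ M"
    by simp
qed

section \<open>The curve as a product over signs of the radius\<close>

text \<open>In the coordinates \<open>u = x + \<i>y = p\<^sup>2\<close> and \<open>v = x - \<i>y = q\<^sup>2\<close> the radius is \<open>\<plusminus>pq\<close>, and the set
  \<open>J\<close> consists of the signs of the radius needed to make the product a polynomial in \<open>u, v\<close>.\<close>

locale signed_product =
  fixes n d :: nat and J :: "complex set" and T :: "complex poly" and F :: "complex poly poly"
  assumes n: "n > 0" and d: "d > 0"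
    and finite_J: "finite J" and J_nonempty: "J \<noteq> {}" and zero_notin_J: "0 \<notin> J"
    and even_weight: "even (card J * (n + d))"
    and degree_T: "degree T = d"
    and poly2_F: "\<And>p q. poly2 F (p\<^sup>2) (q\<^sup>2) =
      (\<Prod>e\<in>J. (e * p * q) ^ n * poly T (e * p * q) - (p ^ (2 * n) + q ^ (2 * n)))"
begin

text \<open>The restriction of \<open>F\<close> to the line with direction \<open>(p^2, q^2)\<close>
  in the coordinates \<open>u, v\<close>, as a polynomial in the line parameter, with its forced
  power removed.\<close>

definition line_poly :: "complex \<Rightarrow> complex \<Rightarrow> complex poly" where
  "line_poly p q = (\<Prod>e\<in>J. smult ((e * p * q) ^ n) (pcompose T [:0, e * p * q:]) -
     [:p ^ (2 * n) + q ^ (2 * n):])"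

definition lead_const :: complex where
  "lead_const = (\<Prod>e\<in>J. e ^ (n + d) * lead_coeff T)"

lemma lead_const_nonzero: "lead_const \<noteq> 0"
  using zero_notin_J finite_J degree_T d by (auto simp: lead_const_def)

lemma poly2_F_sym: "poly2 F u v = poly2 F v u"
  using poly2_F [of "csqrt u" "csqrt v"] poly2_F [of "csqrt v" "csqrt u"]
  by (simp add: mult_ac add_ac)

text \<open>With \<open>c = s^2\<close>, scaling sends \<open>p, q\<close> to
  \<open>s * p, s * q\<close> and \<open>e * p * q\<close> to \<open>c * (e * p * q)\<close>. Each
  factor releases \<open>c ^ n\<close>, which will be the multiplicity at the origin.\<close>

lemma poly2_F_line: "poly2 F (c * p\<^sup>2) (c * q\<^sup>2) = c ^ (n * card J) * poly (line_poly p q) c"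
proof -
  define s where "s = csqrt c"
  have c: "c = s\<^sup>2"
    by (simp add: s_def)
  have "poly2 F (c * p\<^sup>2) (c * q\<^sup>2) = poly2 F ((s * p)\<^sup>2) ((s * q)\<^sup>2)"
    by (simp add: c power_mult_distrib)
  also have "\<dots> = (\<Prod>e\<in>J. c ^ n * ((e * p * q) ^ n * poly T (c * (e * p * q)) - (p ^ (2 * n) + q ^ (2 * n))))"
    unfolding poly2_F
  proof (intro prod.cong refl)
    fix e
    have "e * (s * p) * (s * q) = c * (e * p * q)"
      by (simp add: c power2_eq_square)
    moreover have "(s * p) ^ (2 * n) = c ^ n * p ^ (2 * n)" "(s * q) ^ (2 * n) = c ^ n * q ^ (2 * n)"
      by (simp_all only: c power_mult power_mult_distrib)
    ultimately show "(e * (s * p) * (s * q)) ^ n * poly T (e * (s * p) * (s * q)) -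
          ((s * p) ^ (2 * n) + (s * q) ^ (2 * n)) =
        c ^ n * ((e * p * q) ^ n * poly T (c * (e * p * q)) - (p ^ (2 * n) + q ^ (2 * n)))"
      by (simp only: power_mult_distrib [of c]) (simp only: algebra_simps)
  qed
  also have "\<dots> = c ^ (n * card J) * poly (line_poly p q) c"
    by (simp add: line_poly_def poly_prod poly_pcompose prod.distrib power_mult)
  finally show ?thesis .
qed

text \<open>The top coefficient vanishes on the isotropic lines \<open>u = 0\<close> and
  \<open>v = 0\<close>, which join the origin to the absolute points; elsewhere the bound is
  attained.\<close>

lemma degree_line_poly: "degree (line_poly p q) \<le> card J * d"
  and coeff_line_poly: "coeff (line_poly p q) (card J * d) = lead_const * (p * q) ^ (card J * (n + d))"
proof -
  let ?f = "\<lambda>e. smult ((e * p * q) ^ n) (pcompose T [:0, e * p * q:]) - [:p ^ (2 * n) + q ^ (2 * n):]"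
  have "degree (?f e) \<le> d" for e
    using degree_T d
    by (intro degree_diff_le order.trans [OF degree_smult_le] order.trans [OF degree_pcompose_le]) auto
  then have *: "degree (prod ?f J) \<le> card J * d \<and>
      coeff (prod ?f J) (card J * d) = (\<Prod>e\<in>J. coeff (?f e) d)"
    using finite_J by (intro degree_coeff_prod) auto
  have "coeff (?f e) d = e ^ (n + d) * lead_coeff T * (p * q) ^ (n + d)" for e
    using d by (simp add: coeff_pcompose_linear coeff_pCons degree_T power_add power_mult_distrib
        split: nat.split)
  then have "(\<Prod>e\<in>J. coeff (?f e) d) = lead_const * (p * q) ^ (card J * (n + d))"
    by (simp add: lead_const_def prod.distrib power_mult mult.commute [of "card J"])
  with * show "degree (line_poly p q) \<le> card J * d"
    "coeff (line_poly p q) (card J * d) = lead_const * (p * q) ^ (card J * (n + d))"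
    by (simp_all add: line_poly_def)
qed

text \<open>For \<open>q = 0\<close> the term with \<open>T\<close> drops out because
  \<open>n > 0\<close>. The rest is nonzero away from the origin, which later allows cancelling
  \<open>u\<close> and \<open>v\<close>.\<close>

lemma poly2_F_axis: "poly2 F u 0 = (- (u ^ n)) ^ card J"
  using poly2_F [of "csqrt u" 0] n by (simp add: power_mult power_0_left)

lemma poly2_F_axis': "poly2 F 0 v = (- (v ^ n)) ^ card J"
  using poly2_F_axis [of v] by (simp add: poly2_F_sym)

text \<open>The elements of \<open>Y\<close> are square roots of slopes \<open>z = u / v\<close>,
  because \<open>line_poly\<close> takes square roots of the direction.\<close>

lemma F_dvd:
  assumes "infinite Y"
    and ex: "\<And>y. y \<in> Y \<Longrightarrow> \<exists>V. card J * d \<le> card V \<and>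
      (\<forall>v\<in>V. poly2 G (v * y\<^sup>2) v = 0 \<and> poly (line_poly y 1) v = 0)"
  shows "F dvd G"
proof -
  obtain V where card_V: "\<And>y. y \<in> Y \<Longrightarrow> card J * d \<le> card (V y)"
    and V: "\<And>y v. y \<in> Y \<Longrightarrow> v \<in> V y \<Longrightarrow> poly2 G (v * y\<^sup>2) v = 0 \<and> poly (line_poly y 1) v = 0"
    using ex by metis
  let ?m = "card J"
  obtain j where j: "?m * (n + d) = 2 * j"
    using even_weight by blast
  have "polyfun2 (\<lambda>z v. poly2 F (v * z) v)" "polyfun2 (\<lambda>z v. poly2 G (v * z) v)"
    by (intro polyfun2_intros)+
  then obtain Fb Gb where Fb: "\<And>z v. poly2 Fb z v = poly2 F (v * z) v"
    and Gb: "\<And>z v. poly2 Gb z v = poly2 G (v * z) v"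
    unfolding polyfun2_def by blast
  have slice_Fb: "slice Fb (y\<^sup>2) = monom 1 (n * ?m) * line_poly y 1" for y
    using poly2_F_line [of _ y 1] by (intro poly_eq_if_nonzero) (simp add: Fb poly_monom)
  \<comment> \<open>Every complex \<open>z\<close> is a square, so the factorizations on the single
    lines give divisibility of \<open>Fb\<close> itself.\<close>
  have "poly (coeff Fb k) z = 0" if "k < n * ?m" for k z
    using arg_cong [OF slice_Fb [of "csqrt z"], of "\<lambda>p. coeff p k"] that
    by (simp add: coeff_monom_mult)
  then have "monom 1 (n * ?m) dvd Fb"
    by (simp add: monom_1_dvd_iff' poly_all_0_iff_0 [symmetric])
  then obtain K where K: "Fb = monom 1 (n * ?m) * K"
    by blast
  have slice_K: "slice K (y\<^sup>2) = line_poly y 1" for y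
    using slice_Fb [of y] by (simp add: K slice_mult)
  have coeff_K: "poly (coeff K k) z = coeff (line_poly (csqrt z) 1) k" for k z
    by (metis coeff_slice power2_csqrt slice_K)
  have "coeff K k = 0" if "k > ?m * d" for k
    using le_less_trans [OF degree_line_poly that]
    by (intro poly_eq_if_nonzero) (simp add: coeff_K coeff_eq_0)
  then have "degree K \<le> ?m * d"
    by (simp add: degree_le)
  \<comment> \<open>Even weight turns the power of \<open>csqrt z\<close> into \<open>z ^ j\<close>.
    As this leading coefficient is a monomial, pseudo-division multiplies \<open>Gb\<close> only by
    a constant and a power of \<open>z\<close>.\<close>
  moreover have top: "coeff K (?m * d) = monom lead_const j"
  proof (rule poly_eq_if_nonzero)
    fix z :: complex
    have "csqrt z ^ (?m * (n + d)) = z ^ j"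
      by (simp add: j power_mult)
    then show "poly (coeff K (?m * d)) z = poly (monom lead_const j) z"
      by (simp add: coeff_K coeff_line_poly poly_monom)
  qed
  ultimately have degree_K: "degree K = ?m * d"
    using lead_const_nonzero by (intro antisym le_degree) auto
  with top have lead_K: "lead_coeff K = monom lead_const j"
    by simp
  then have K0: "K \<noteq> 0"
    using lead_const_nonzero by auto
  obtain Q R where QR: "pseudo_divmod Gb K = (Q, R)"
    by fastforce
  define N where "N = Suc (degree Gb) - degree K"
  have eq: "smult (lead_coeff K ^ N) Gb = K * Q + R" and R: "R = 0 \<or> degree R < ?m * d"
    using pseudo_divmod [OF K0 QR] by (simp_all add: N_def degree_K)
  have "R = 0"
  proof (rule ccontr)
    assume "R \<noteq> 0"
    with R have degR: "degree R < ?m * d"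
      by simp
    \<comment> \<open>\<open>Gb\<close> and \<open>K\<close> both vanish on \<open>V y\<close>,
      which has more elements than the degree of the remainder.\<close>
    have "slice R (y\<^sup>2) = 0" if y: "y \<in> Y" for y
    proof (rule poly_eqI_degree)
      fix v assume "v \<in> V y"
      then have "poly2 Gb (y\<^sup>2) v = 0" "poly2 K (y\<^sup>2) v = 0"
        using V [OF y] by (simp_all add: Gb flip: slice_K)
      then show "poly (slice R (y\<^sup>2)) v = poly 0 v"
        using arg_cong [OF eq, of "\<lambda>P. poly2 P (y\<^sup>2) v"] by simp
    next
      show "degree (slice R (y\<^sup>2)) < card (V y)" "degree 0 < card (V y)"
        using degR card_V [OF y] degree_slice_le [of R "y\<^sup>2"] by auto
    qed
    then have coeff_R: "poly (coeff R k) z = 0" if "z \<in> power2 ` Y" for k z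
      using that by (auto simp flip: coeff_slice)
    \<comment> \<open>Squaring is at most two to one.\<close>
    have "infinite (power2 ` Y)"
    proof
      assume "finite (power2 ` Y)"
      then have "finite (\<Union>z\<in>power2 ` Y. {y :: complex. poly [:- z, 0, 1:] y = 0})"
        by (intro finite_UN_I poly_roots_finite) auto
      moreover have "Y \<subseteq> (\<Union>z\<in>power2 ` Y. {y :: complex. poly [:- z, 0, 1:] y = 0})"
        by (auto simp: power2_eq_square)
      ultimately show False
        using assms(1) finite_subset by blast
    qed
    then have "coeff R k = 0" for k
      using coeff_R by (intro poly_eq_if_infinite [of "power2 ` Y"]) auto
    with \<open>R \<noteq> 0\<close> show False
      by (simp add: poly_eq_iff)
  qed
  obtain L Q' where Q': "\<And>u v. v \<noteq> 0 \<Longrightarrow> v ^ L * poly2 Q (u / v) v = poly2 Q' u v"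
    using laurent_in_snd_poly2 [of Q] unfolding laurent_in_snd_def by blast
  let ?U = "[:[:0, 1:]:] :: complex poly poly" and ?V = "[:0, 1:] :: complex poly poly"
  \<comment> \<open>The pseudo-division with \<open>z = u / v\<close> and denominators cleared. The
    powers of \<open>u\<close> and \<open>v\<close> beside \<open>G\<close> are cancelled
    afterwards.\<close>
  have "?U ^ (j * N) * (?V ^ (n * ?m + L) * G) =
      F * (?V ^ (j * N) * smult [:1 / lead_const ^ N:] Q')"
  proof (rule poly2_eqI)
    fix u v :: complex assume v: "v \<noteq> 0"
    have "(lead_const * (u / v) ^ j) ^ N * poly2 G u v = poly2 K (u / v) v * poly2 Q (u / v) v"
      using arg_cong [OF eq, of "\<lambda>P. poly2 P (u / v) v"] v
      by (simp add: \<open>R = 0\<close> lead_K Gb poly_monom)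
    moreover have "poly2 F u v = v ^ (n * ?m) * poly2 K (u / v) v"
      using Fb [of "u / v" v] v by (simp add: K)
    ultimately have "v ^ (n * ?m) * v ^ L * ((lead_const * (u / v) ^ j) ^ N * poly2 G u v) =
        poly2 F u v * poly2 Q' u v"
      using Q' [OF v, of u] by (simp add: algebra_simps)
    then have "u ^ (j * N) * v ^ (n * ?m + L) * (lead_const ^ N * poly2 G u v) =
        v ^ (j * N) * (poly2 F u v * poly2 Q' u v)"
      using v by (simp add: field_simps power_add flip: power_mult)
    then show "poly2 (?U ^ (j * N) * (?V ^ (n * ?m + L) * G)) u v =
        poly2 (F * (?V ^ (j * N) * smult [:1 / lead_const ^ N:] Q')) u v"
      using lead_const_nonzero by (simp add: poly2_pCons field_simps)
  qed
  then have "F dvd ?U ^ (j * N) * (?V ^ (n * ?m + L) * G)"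
    by (rule dvdI)
  moreover have "F dvd A" if "F dvd ?U * A" for A
    using that by (rule dvd_cancel_fst [rotated]) (simp add: poly2_F_axis')
  ultimately have "F dvd ?V ^ (n * ?m + L) * G"
    using dvd_if_dvd_power_mult by blast
  moreover have "F dvd A" if "F dvd ?V * A" for A
    using that by (rule dvd_cancel_snd [rotated]) (simp add: poly2_F_axis)
  ultimately show "F dvd G"
    using dvd_if_dvd_power_mult by blast
qed

text \<open>With \<open>u = p^2\<close> and \<open>v = q^2\<close>, each factor is a polynomial in
  \<open>q\<close> with competing top degrees \<open>n + d\<close> (from \<open>T\<close>) and
  \<open>2 * n\<close>. As \<open>n \<noteq> d\<close>, they cannot cancel for \<open>u = 1\<close>.
  The factor 2 reflects that \<open>q\<close> is a square root of \<open>v\<close>.\<close>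

lemma degree_slice_F:
  assumes "n \<noteq> d"
  shows "2 * degree (slice F u) \<le> card J * max (2 * n) (n + d)"
    and "2 * degree (slice F 1) = card J * max (2 * n) (n + d)"
proof -
  let ?M = "max (2 * n) (n + d)"
  define f where "f p e = smult ((e * p) ^ n) (monom 1 n * pcompose T [:0, e * p:]) -
    (monom 1 (2 * n) + [:p ^ (2 * n):])" for p e :: complex
  have comp: "pcompose (slice F (p\<^sup>2)) [:0, 0, 1:] = prod (f p) J" for p
  proof (rule poly_eq_if_nonzero)
    fix q :: complex
    show "poly (pcompose (slice F (p\<^sup>2)) [:0, 0, 1:]) q = poly (prod (f p) J) q"
      using poly2_F [of p q]
      by (simp add: poly_pcompose f_def poly_prod poly_monom power2_eq_square power_mult_distrib mult_ac add_ac)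
  qed
  have degree_f: "degree (f p e) \<le> ?M" for p e
  proof -
    have "degree (monom 1 n * pcompose T [:0, e * p:]) \<le> n + d"
      using degree_T by (intro order.trans [OF degree_mult_le] add_mono degree_monom_le
        order.trans [OF degree_pcompose_le]) auto
    then show ?thesis
      unfolding f_def
      by (intro degree_diff_le degree_add_le order.trans [OF degree_smult_le]
            order.trans [OF degree_monom_le]) auto
  qed
  have *: "degree (prod (f p) J) \<le> card J * ?M \<and>
      coeff (prod (f p) J) (card J * ?M) = (\<Prod>e\<in>J. coeff (f p e) ?M)" for p
    using finite_J degree_f by (intro degree_coeff_prod) auto
  have deg: "2 * degree (slice F (p\<^sup>2)) = degree (prod (f p) J)" for p
    by (simp add: degree_pcompose flip: comp)
  show "2 * degree (slice F u) \<le> card J * ?M"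
    using deg [of "csqrt u"] * [of "csqrt u"] by simp
  have "coeff (f 1 e) ?M \<noteq> 0" if "e \<in> J" for e
  proof (cases "d < n")
    case True
    then have "coeff (f 1 e) ?M = -1"
      using degree_T n
      by (auto simp: f_def coeff_monom_mult coeff_pcompose_linear coeff_pCons coeff_eq_0 max_def
          split: nat.split)
    then show ?thesis
      by simp
  next
    case False
    with assms have "coeff (f 1 e) ?M = e ^ (n + d) * lead_coeff T"
      using degree_T n
      by (auto simp: f_def coeff_monom_mult coeff_pcompose_linear coeff_pCons max_def power_add
          split: nat.split)
    moreover have "e \<noteq> 0"
      using that zero_notin_J by blast
    ultimately show ?thesis
      using degree_T d by auto
  qed
  then have "coeff (prod (f 1) J) (card J * ?M) \<noteq> 0"
    using finite_J * by auto
  then have "degree (prod (f 1) J) = card J * ?M"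
    using * by (intro antisym le_degree) auto
  then show "2 * degree (slice F 1) = card J * ?M"
    using deg [of 1] by simp
qed

section \<open>Order and multiplicities in Cartesian coordinates\<close>

context
  fixes E :: "complex poly poly"
  assumes poly2_E: "\<And>x y. poly2 E x y = poly2 F (x + \<i> * y) (x - \<i> * y)"
begin

lemma poly2_E_line:
  "poly2 E x (x * y) = x ^ (n * card J) * poly (line_poly (csqrt (1 + \<i> * y)) (csqrt (1 - \<i> * y))) x"
  using poly2_F_line [of x "csqrt (1 + \<i> * y)" "csqrt (1 - \<i> * y)"]
  by (simp add: poly2_E algebra_simps)

lemma total_degree_E: "total_degree E = card J * (n + d)"
proof (rule total_degree_eqI)
  fix y
  let ?p = "monom 1 (n * card J) * line_poly (csqrt (1 + \<i> * y)) (csqrt (1 - \<i> * y))"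
  have "degree ?p \<le> n * card J + card J * d"
    by (intro order.trans [OF degree_mult_le] add_mono degree_monom_le degree_line_poly)
  then have "degree ?p \<le> card J * (n + d)"
    by (simp add: algebra_simps)
  then show "\<exists>p. degree p \<le> card J * (n + d) \<and> (\<forall>x. x \<noteq> 0 \<longrightarrow> poly2 E x (x * y) = poly p x)"
    by (intro exI [of _ ?p]) (simp add: poly2_E_line poly_monom)
next
  \<comment> \<open>The line of slope \<open>0\<close> has \<open>p = q = 1\<close>, so its top
    coefficient is \<open>lead_const\<close>.\<close>
  show "\<forall>x. x \<noteq> 0 \<longrightarrow> poly2 E x (x * 0) = poly (monom 1 (n * card J) * line_poly 1 1) x"
    using poly2_E_line [of _ 0] by (simp add: poly_monom)
  have "card J * (n + d) = card J * d + n * card J"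
    by (simp add: algebra_simps)
  then show "coeff (monom 1 (n * card J) * line_poly 1 1) (card J * (n + d)) \<noteq> 0"
    using coeff_line_poly [of 1 1] lead_const_nonzero by (simp add: coeff_monom_mult)
qed

lemma multiplicity_origin_E: "point_multiplicity E (1, 0, 0) = n * card J"
  unfolding point_multiplicity_origin
proof (rule least_degree_eqI)
  show "\<exists>p. \<forall>x. x \<noteq> 0 \<longrightarrow> poly2 E x (x * y) = x ^ (n * card J) * poly p x" for y
    using poly2_E_line by blast
  \<comment> \<open>Slope \<open>\<i>\<close> gives the isotropic line \<open>u = 0\<close>,
    \<open>v = 2 * x\<close>, on which every factor of \<open>line_poly\<close> is a nonzero
    constant.\<close>
  show "\<forall>x. x \<noteq> 0 \<longrightarrow> poly2 E x (x * \<i>) = x ^ (n * card J) * poly (line_poly 0 (csqrt 2)) x"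
    using poly2_E_line [of _ \<i>] by simp
  show "poly (line_poly 0 (csqrt 2)) 0 \<noteq> 0"
    using n finite_J by (simp add: line_poly_def poly_prod power_0_left)
qed

text \<open>The affine lines through an absolute point are those on which \<open>u\<close>,
  respectively \<open>v\<close>, is constant. There \<open>F\<close> has degree at most
  \<open>M\<close> in the other coordinate, so homogenizing to degree \<open>?D\<close> leaves the
  factor \<open>x ^ (?D - M)\<close>.\<close>

lemma multiplicity_absolute_E:
  assumes "n \<noteq> d" "c = \<i> \<or> c = - \<i>" "2 * M = card J * max (2 * n) (n + d)"
  shows "point_multiplicity E (0, 1, c) = card J * (n + d) - M"
proof -
  let ?D = "card J * (n + d)"
  have deg: "degree (slice F u) \<le> M" "degree (slice F 1) = M" for u
    using degree_slice_F(1) [OF assms(1), of u] degree_slice_F(2) [OF assms(1)] assms(3)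
    by linarith+
  have "card J * max (2 * n) (n + d) \<le> card J * (2 * (n + d))"
    by (intro mult_left_mono) auto
  then have "M \<le> ?D"
    using assms(3) by (simp add: algebra_simps)
  have loc: "poly2 (local_equation E (0, 1, c)) x (x * t) =
      x ^ (?D - M) * (x ^ M * poly (slice F (c * t)) ((2 - c * t * x) / x))" if "x \<noteq> 0" for x t
  proof -
    have "poly2 E (1 / x) ((c + x * t) / x) = poly2 F (c * t) ((2 - c * t * x) / x)"
      using assms(2)
    proof
      assume c: "c = \<i>"
      have "1 / x + \<i> * ((c + x * t) / x) = c * t" "1 / x - \<i> * ((c + x * t) / x) = (2 - c * t * x) / x"
        using that by (simp_all add: c field_simps)
      then show ?thesis
        by (simp add: poly2_E)
    next
      assume c: "c = - \<i>"
      have "1 / x - \<i> * ((c + x * t) / x) = c * t" "1 / x + \<i> * ((c + x * t) / x) = (2 - c * t * x) / x"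
        using that by (simp_all add: c field_simps)
      then show ?thesis
        by (simp add: poly2_E poly2_F_sym [of "c * t"])
    qed
    moreover have "x ^ ?D = x ^ (?D - M) * x ^ M"
      using \<open>M \<le> ?D\<close> by (simp flip: power_add)
    ultimately show ?thesis
      using that by (simp add: poly2_local_equation_infinity total_degree_E)
  qed
  have red: "\<exists>p. (\<forall>x. x \<noteq> 0 \<longrightarrow> poly2 (local_equation E (0, 1, c)) x (x * t) = x ^ (?D - M) * poly p x) \<and>
      poly p 0 = coeff (slice F (c * t)) M * 2 ^ M" for t
    using poly_reversal [OF deg(1), of "c * t" 2 "c * t"] loc by metis
  have ct: "c * (1 / c) = 1"
    using assms(2) by auto
  show ?thesis
    unfolding point_multiplicity_def
  proof -
    \<comment> \<open>Slope \<open>1 / c\<close> makes the constant coordinate \<open>1\<close>,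
      where degree \<open>M\<close> is attained.\<close>
    obtain p where p: "\<forall>x. x \<noteq> 0 \<longrightarrow>
        poly2 (local_equation E (0, 1, c)) x (x * (1 / c)) = x ^ (?D - M) * poly p x"
      "poly p 0 = lead_coeff (slice F 1) * 2 ^ M"
      using red [of "1 / c"] unfolding ct deg(2) by blast
    have "slice F 1 \<noteq> 0"
      using poly2_F_axis' poly2_F_axis [of 1]
      by (metis poly_0 poly_slice power_eq_0_iff neg_equal_0_iff_equal one_neq_zero power_one)
    then have "poly p 0 \<noteq> 0"
      by (simp add: p(2) del: coeff_slice)
    with p(1) red show "least_degree (local_equation E (0, 1, c)) = ?D - M"
      by (intro least_degree_eqI [of _ _ "1 / c" p]) blast+
  qed
qed

end

end

section \<open>Chebyshev polynomials and lines through the origin\<close>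

fun cheb :: "nat \<Rightarrow> complex poly" where
  "cheb 0 = 1"
| "cheb (Suc 0) = [:0, 1:]"
| "cheb (Suc (Suc k)) = [:0, 2:] * cheb (Suc k) - cheb k"

lemma poly_cheb_cos: "poly (cheb k) (of_real (cos x)) = of_real (cos (real k * x))"
proof (induction k rule: cheb.induct)
  case (3 k)
  have "cos (real (Suc (Suc k)) * x) = 2 * cos x * cos (real (Suc k) * x) - cos (real k * x)"
    using cos_plus_cos [of "real (Suc (Suc k)) * x" "real k * x"]
    by (simp add: algebra_simps add_divide_distrib)
  then have "complex_of_real (cos (real (Suc (Suc k)) * x)) =
      2 * of_real (cos x) * of_real (cos (real (Suc k) * x)) - of_real (cos (real k * x))"
    by (simp only: of_real_diff of_real_mult of_real_numeral)
  with 3 show ?case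
    by (simp del: of_nat_Suc)
qed auto

lemma degree_cheb: "degree (cheb k) = k"
proof -
  have "degree (cheb k) \<le> k \<and> coeff (cheb k) k \<noteq> 0"
    by (induction k rule: cheb.induct)
       (auto simp: coeff_pCons coeff_eq_0 intro!: degree_diff_le split: nat.split
         intro: order.trans [OF degree_pCons_le] order.trans [OF degree_smult_le])
  then show ?thesis
    by (intro antisym le_degree) auto
qed

lemma poly_cheb_minus: "poly (cheb k) (- x) = (-1) ^ k * poly (cheb k) x"
  by (induction k rule: cheb.induct) (auto simp: algebra_simps)

section \<open>Independence of the choice of the implicit equation\<close>

lemma homogenization_smult:
  fixes c :: "'a::field"
  assumes "c \<noteq> 0"
  shows "homogenization (smult [:c:] F) X0 X1 X2 = smult [:c:] (homogenization F X0 X1 X2)"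
proof -
  have "total_degree (smult [:c:] F) = total_degree F" "degree (smult [:c:] F) = degree F"
    "degree (coeff (smult [:c:] F) j) = degree (coeff F j)"
    "[:[:coeff2 (smult [:c:] F) i j:]:] = [:[:c:]:] * [:[:coeff2 F i j:]:]" for i j
    using assms by (simp_all add: coeff2_def total_degree_smult)
  moreover have "smult [:c:] P = [:[:c:]:] * P" for P
    by simp
  ultimately show ?thesis
    by (simp only: homogenization_def sum_distrib_left mult.assoc)
qed

lemma point_multiplicity_smult:
  fixes c :: "'a::field"
  assumes "c \<noteq> 0"
  shows "point_multiplicity (smult [:c:] F) p = point_multiplicity F p"
  using assms
  by (simp add: point_multiplicity_def local_equation_def homogenization_smult least_degree_smult
      split: prod.split)

text \<open>Two generators divide each other, and the units are the nonzero constants.\<close>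

lemma implicit_equation_unique:
  assumes "implicit_equation S F" "implicit_equation S G"
  obtains c where "c \<noteq> 0" "G = smult [:c:] F"
proof -
  obtain A B where AB: "G = F * A" "F = G * B" and "F \<noteq> 0"
    using assms unfolding implicit_equation_def by (metis dvdE)
  then have "F * 1 = F * (A * B)"
    by (metis mult.assoc mult_1_right)
  with \<open>F \<noteq> 0\<close> have "A * B = 1"
    by (subst (asm) mult_left_cancel) auto
  then have "A dvd 1"
    by (metis dvdI)
  then obtain c where c: "A = [:[:c:]:]" "c dvd 1"
    by (auto simp: is_unit_poly_iff)
  then have "c \<noteq> 0"
    by auto
  with AB(1) c(1) that show ?thesis
    by simp
qed

lemma cis_eq_imp_dvd:
  fixes s t :: int
  assumes "cis (pi * s / d) = cis (pi * t / d)" "d > 0"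
  shows "2 * int d dvd s - t"
proof -
  have "sin (pi * s / d) = sin (pi * t / d) \<and> cos (pi * s / d) = cos (pi * t / d)"
    using assms(1) by (simp add: complex_eq_iff)
  then obtain i :: int where "pi * s / d = pi * t / d + 2 * pi * i"
    unfolding sin_cos_eq_iff by blast
  then have "pi * s = pi * (t + 2 * d * i)"
    using assms(2) by (simp add: field_simps)
  then have "real_of_int s = real_of_int (t + 2 * int d * i)"
    by simp
  then have "s = t + 2 * int d * i"
    by (simp only: of_int_eq_iff)
  then show ?thesis
    by simp
qed

text \<open>\<open>I\<close> indexes the parameters \<open>\<phi> + pi * k\<close> of curve points
  on the line of angle \<open>\<phi>\<close>. If \<open>a = 0\<close> and \<open>n * d\<close> is
  odd, \<open>k\<close> and \<open>k + d\<close> give the same point, so only even \<open>k\<close>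
  are kept.\<close>

locale cyclic_harmonic_equation = signed_product n d J T F
  for n d :: nat and J T F +
  fixes a :: real and I :: "nat set"
  assumes coprime: "coprime n d"
    and J: "1 \<in> J" "\<And>k. k \<in> I \<Longrightarrow> (-1) ^ k \<in> J"
    and I: "I \<subseteq> {..<2 * d}" "card I = card J * d"
    and even_I: "a = 0 \<Longrightarrow> odd (n * d) \<Longrightarrow> k \<in> I \<Longrightarrow> even k"
    and poly_T: "\<And>\<phi> :: real. poly T (of_real (cos (real n / real d * \<phi>) + a)) = cis (n * \<phi>) + cis (- (n * \<phi>))"
begin

definition radius :: "real \<Rightarrow> real" where
  "radius \<phi> = cos (real n / real d * \<phi>) + a"

lemma cyclic_harmonic_eq:
  "cyclic_harmonic n d a = (\<lambda>\<phi>. (radius \<phi> * cos \<phi>, radius \<phi> * sin \<phi>)) ` {0..2 * real d * pi}"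
  by (simp add: cyclic_harmonic_def radius_def Let_def)

lemma poly_T_radius:
  fixes \<phi> :: real
  shows "poly T (of_real (radius \<phi>)) = cis (n * \<phi>) + cis (- (n * \<phi>))"
  unfolding radius_def by (rule poly_T)

lemma poly2_F_curve: "poly2 F (radius \<phi> * cis \<phi>) (radius \<phi> * cis (- \<phi>)) = 0"
proof -
  define p q where "p = cis (\<phi> / 2)" and "q = cis (- (\<phi> / 2))"
  have sq: "p\<^sup>2 = cis \<phi>" "q\<^sup>2 = cis (- \<phi>)"
    and pow: "p ^ (2 * n) = cis (n * \<phi>)" "q ^ (2 * n) = cis (- (n * \<phi>))"
    and one: "p * q = 1"
    by (simp_all add: p_def q_def Complex.DeMoivre cis_mult)
  \<comment> \<open>As \<open>p * q = 1\<close>, the factor for the sign \<open>1\<close> is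
    \<open>T(r) - 2 cos n\<phi>\<close>, which is zero at the radius.\<close>
  have "poly (line_poly p q) (radius \<phi>) = 0"
    unfolding line_poly_def poly_prod prod_zero_iff [OF finite_J]
    using J(1) by (intro bexI [of _ 1]) (simp_all add: poly_pcompose one pow poly_T_radius)
  then show ?thesis
    using poly2_F_line [of "radius \<phi>" p q] by (simp add: sq)
qed

text \<open>The equations compare the trinomials of \<open>line_point_eq\<close>. The first two give
  that \<open>d\<close> divides \<open>\<delta> * n\<close>, so \<open>\<delta>\<close> is
  \<open>d\<close> or \<open>-d\<close>, and that \<open>n\<close> and \<open>d\<close> are odd.
  Then the third excludes \<open>a \<noteq> 0\<close>, and the parity of \<open>I\<close> excludes
  \<open>a = 0\<close>.\<close>

lemma lines_nondegenerate:
  assumes "k \<in> I" "l \<in> I" "k \<noteq> l"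
    and "cis (pi * (int k * (int n - int d)) / d) = cis (pi * (int l * (int n - int d)) / d)"
    and "cis (pi * (- int k * (int n + int d)) / d) = cis (pi * (- int l * (int n + int d)) / d)"
    and "a = 0 \<or> cis (pi * (- int k * int d) / d) = cis (pi * (- int l * int d) / d)"
  shows False
proof -
  define \<delta> where "\<delta> = int k - int l"
  have "k < 2 * d" "l < 2 * d"
    using assms(1,2) I(1) by auto
  then have \<delta>: "\<delta> \<noteq> 0" "\<bar>\<delta>\<bar> < 2 * int d"
    using assms(3) unfolding \<delta>_def by linarith+
  have "2 * int d dvd \<delta> * (int n - int d)"
    using cis_eq_imp_dvd [OF assms(4) d] by (simp add: \<delta>_def algebra_simps)
  moreover have sum: "2 * int d dvd \<delta> * (int n + int d)"
    using cis_eq_imp_dvd [OF assms(5) d] dvd_minus_iff [of "2 * int d" "\<delta> * (int n + int d)"]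
    by (simp add: \<delta>_def algebra_simps)
  ultimately have "2 * int d dvd \<delta> * (int n - int d) + \<delta> * (int n + int d)"
    by (rule dvd_add)
  then have "2 * int d dvd 2 * (\<delta> * int n)"
    by (simp add: algebra_simps)
  then have "int d dvd \<delta> * int n"
    by (simp only: dvd_mult_cancel_left) simp
  then have "int d dvd \<delta>"
    using coprime by (simp add: coprime_dvd_mult_left_iff coprime_commute)
  then obtain q where q: "\<delta> = int d * q"
    by blast
  with \<delta> d have "q \<noteq> 0" "\<bar>q\<bar> < 2"
    by (auto simp: abs_mult mult.commute)
  then have "q = 1 \<or> q = -1"
    by linarith
  then have \<delta>_eq: "\<delta> = int d \<or> \<delta> = - int d"
    using q by auto
  with sum have "2 * int d dvd int d * (int n + int d)"
    by auto
  then have "2 dvd int n + int d"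
    using d by (simp add: mult.commute [of 2])
  then have "even n \<longleftrightarrow> even d"
    by presburger
  with coprime have odd: "odd n" "odd d"
    by (auto simp: coprime_def)
  have "a = 0"
  proof (rule ccontr)
    assume "a \<noteq> 0"
    with assms(6) have "2 * int d dvd \<delta> * int d"
      using cis_eq_imp_dvd [OF _ d, of "- int k * int d" "- int l * int d"]
        dvd_minus_iff [of "2 * int d" "\<delta> * int d"]
      by (simp add: \<delta>_def algebra_simps)
    then have "2 dvd \<delta>"
      using d by simp
    with \<delta>_eq odd(2) show False
      by auto
  qed
  then have "even k" "even l"
    using even_I odd assms(1,2) by auto
  with \<delta>_eq odd(2) show False
    unfolding \<delta>_def by presburger
qed

text \<open>The coordinate \<open>v\<close> of a curve point. It determines the point, since
  \<open>u = v * cis (2 * \<phi>)\<close> on the line.\<close>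

definition line_point :: "real \<Rightarrow> nat \<Rightarrow> complex" where
  "line_point \<phi> k = radius (\<phi> + pi * k) * cis (- (\<phi> + pi * k))"

text \<open>Clearing negative powers of \<open>w = cis (\<phi> / d)\<close> leaves a trinomial in
  \<open>w\<close> whose coefficients do not depend on \<open>\<phi>\<close>.\<close>

lemma line_point_eq:
  fixes \<phi> :: real
  shows "2 * line_point \<phi> k * cis (\<phi> / d) ^ (n + d) =
     cis (pi * (int k * (int n - int d)) / d) * cis (\<phi> / d) ^ (2 * n) +
     2 * a * cis (pi * (- int k * int d) / d) * cis (\<phi> / d) ^ n +
     cis (pi * (- int k * (int n + int d)) / d)"
proof -
  define \<psi> where "\<psi> = \<phi> + pi * k"
  have cos: "2 * complex_of_real (cos x) = cis x + cis (- x)" for x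
    by (simp add: complex_eq_iff)
  have "2 * line_point \<phi> k = (cis (n / d * \<psi>) + cis (- (n / d * \<psi>)) + 2 * a) * cis (- \<psi>)"
    unfolding line_point_def radius_def \<psi>_def [symmetric] of_real_add mult.assoc [symmetric]
      distrib_left cos by simp
  moreover have "cis (\<phi> / d) ^ (n + d) = cis ((n + d) * \<phi> / d)" "cis (\<phi> / d) ^ (2 * n) = cis (2 * n * \<phi> / d)"
    "cis (\<phi> / d) ^ n = cis (n * \<phi> / d)"
    by (simp_all add: Complex.DeMoivre)
  moreover have "n / d * \<psi> + (- \<psi>) + (n + d) * \<phi> / d =
      pi * (int k * (int n - int d)) / d + 2 * n * \<phi> / d"
    "- (n / d * \<psi>) + (- \<psi>) + (n + d) * \<phi> / d = pi * (- int k * (int n + int d)) / d"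
    "(- \<psi>) + (n + d) * \<phi> / d = pi * (- int k * int d) / d + n * \<phi> / d"
    using d by (simp_all add: \<psi>_def field_simps)
  ultimately show ?thesis
    by (simp only: distrib_right cis_mult mult.assoc) (simp add: mult.assoc cis_mult)
qed

text \<open>Collisions give roots \<open>w\<close> of the difference of two trinomials, which is
  nonzero, and \<open>w\<close> determines \<open>\<phi>\<close> in the half-open interval.\<close>

lemma finite_line_point_collisions:
  assumes "k \<in> I" "l \<in> I" "k \<noteq> l"
  shows "finite {\<phi> \<in> {0..<pi}. line_point \<phi> k = line_point \<phi> l}"
proof -
  define A B C where
    "A k = cis (pi * (int k * (int n - int d)) / d)" and
    "B k = cis (pi * (- int k * (int n + int d)) / d)" and
    "C k = 2 * a * cis (pi * (- int k * int d) / d)" for k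
  define P where "P = monom (A k - A l) (2 * n) + monom (C k - C l) n + [:B k - B l:]"
  have coeffs: "coeff P (2 * n) = A k - A l" "coeff P n = C k - C l" "coeff P 0 = B k - B l"
    using n by (auto simp: P_def coeff_pCons split: nat.split)
  have "P \<noteq> 0"
  proof
    assume "P = 0"
    with coeffs have "A k = A l" "B k = B l" "C k = C l"
      by simp_all
    then show False
      using lines_nondegenerate [OF assms] by (auto simp: A_def B_def C_def)
  qed
  have "poly P (cis (\<phi> / d)) = 0" if "line_point \<phi> k = line_point \<phi> l" for \<phi>
  proof -
    have "poly P (cis (\<phi> / d)) = (A k * cis (\<phi> / d) ^ (2 * n) + C k * cis (\<phi> / d) ^ n + B k) -
        (A l * cis (\<phi> / d) ^ (2 * n) + C l * cis (\<phi> / d) ^ n + B l)"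
      by (simp add: P_def poly_monom algebra_simps)
    also have "\<dots> = 0"
      using line_point_eq [of \<phi> k] line_point_eq [of \<phi> l] that by (simp add: A_def B_def C_def)
    finally show ?thesis .
  qed
  then have "(\<lambda>\<phi>. cis (\<phi> / d)) ` {\<phi> \<in> {0..<pi}. line_point \<phi> k = line_point \<phi> l} \<subseteq>
      {w. poly P w = 0}"
    by auto
  then have "finite ((\<lambda>\<phi>. cis (\<phi> / d)) ` {\<phi> \<in> {0..<pi}. line_point \<phi> k = line_point \<phi> l})"
    using poly_roots_finite [OF \<open>P \<noteq> 0\<close>] finite_subset by blast
  moreover have "inj_on (\<lambda>\<phi>. cis (\<phi> / d)) {0..<pi}"
  proof (rule inj_onI)
    fix x y assume *: "x \<in> {0..<pi}" "y \<in> {0..<pi}" "cis (x / d) = cis (y / d)"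
    have "0 \<le> t / d \<and> t / d \<le> pi" if "t \<in> {0..<pi}" for t
      using that d pi_ge_zero by (auto simp: divide_le_eq intro: order.trans [of t pi "pi * d"])
    moreover have "cos (x / d) = cos (y / d)"
      using *(3) by (simp add: complex_eq_iff)
    ultimately have "x / d = y / d"
      using *(1,2) by - (rule cos_inj_pi; blast)
    with d show "x = y"
      by simp
  qed
  ultimately show ?thesis
    by (elim finite_imageD inj_on_subset) blast
qed

lemma implicit_equation_cyclic_harmonic:
  assumes E: "\<And>x y. poly2 E x y = poly2 F (x + \<i> * y) (x - \<i> * y)"
  shows "implicit_equation (cyclic_harmonic n d a) E"
  unfolding implicit_equation_def
proof (intro conjI allI impI)
  \<comment> \<open>The point with \<open>u = 1\<close> and \<open>v = 0\<close>.\<close>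
  have "poly2 E (1 / 2) (1 / (2 * \<i>)) \<noteq> 0"
    using poly2_F_axis [of 1] by (simp add: E)
  then show "E \<noteq> 0"
    by auto
  have polar: "of_real (r * cos \<phi>) + \<i> * of_real (r * sin \<phi>) = r * cis \<phi>"
    "of_real (r * cos \<phi>) - \<i> * of_real (r * sin \<phi>) = r * cis (- \<phi>)" for r \<phi> :: real
    by (simp_all add: complex_eq_iff)
  show "vanishes_on E (cyclic_harmonic n d a)"
    by (auto simp: vanishes_on_def cyclic_harmonic_eq E polar poly2_F_curve simp del: of_real_mult)
  fix H assume H: "vanishes_on H (cyclic_harmonic n d a)"
  have "polyfun2 (\<lambda>u v. poly2 H (1 / 2 * (u + v)) (1 / (2 * \<i>) * (u - v)))"
    by (intro polyfun2_intros)
  then obtain G where G: "\<And>u v. poly2 G u v = poly2 H (1 / 2 * (u + v)) (1 / (2 * \<i>) * (u - v))"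
    unfolding polyfun2_def by blast
  have G_curve: "poly2 G (radius \<phi> * cis \<phi>) (radius \<phi> * cis (- \<phi>)) = 0"
    if "\<phi> \<in> {0..2 * real d * pi}" for \<phi>
  proof -
    have "1 / 2 * (radius \<phi> * cis \<phi> + radius \<phi> * cis (- \<phi>)) = of_real (radius \<phi> * cos \<phi>)"
      "1 / (2 * \<i>) * (radius \<phi> * cis \<phi> - radius \<phi> * cis (- \<phi>)) = of_real (radius \<phi> * sin \<phi>)"
      by (simp_all flip: polar)
    with H that show ?thesis
      unfolding G by (auto simp: vanishes_on_def cyclic_harmonic_eq simp del: of_real_mult)
  qed
  \<comment> \<open>On lines with other angles the indexed points are distinct, and there are
    \<open>card J * d\<close> of them, as \<open>F_dvd\<close> demands.\<close>
  define bad where "bad = (\<Union>k\<in>I. \<Union>l\<in>I - {k}. {\<phi> \<in> {0..<pi}. line_point \<phi> k = line_point \<phi> l})"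
  have "finite I"
    using I(1) finite_subset by blast
  then have "finite bad"
    unfolding bad_def by (intro finite_UN_I finite_line_point_collisions) auto
  then have infinite: "infinite ({0..<pi} - bad)"
    by (intro Diff_infinite_finite) (auto simp: infinite_Ico)
  have "inj_on cis ({0..<pi} - bad)"
    by (rule inj_onI, rule cos_inj_pi) (auto simp: complex_eq_iff)
  then have inf_Y: "infinite (cis ` ({0..<pi} - bad))"
    using infinite finite_imageD by blast
  have "F dvd G"
  proof (rule F_dvd [OF inf_Y])
    fix y assume "y \<in> cis ` ({0..<pi} - bad)"
    then obtain \<phi> where y: "y = cis \<phi>" and \<phi>: "0 \<le> \<phi>" "\<phi> < pi" "\<phi> \<notin> bad"
      by auto
    have "inj_on (line_point \<phi>) I"
      using \<phi> by (auto simp: inj_on_def bad_def)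
    then have "card (line_point \<phi> ` I) = card J * d"
      by (simp add: card_image I(2))
    moreover have "poly2 G (line_point \<phi> k * y\<^sup>2) (line_point \<phi> k) = 0 \<and>
        poly (line_poly y 1) (line_point \<phi> k) = 0" if k: "k \<in> I" for k
    proof
      define \<psi> where "\<psi> = \<phi> + pi * k"
      have sgn: "cis (pi * k) = (-1) ^ k"
        using Complex.DeMoivre [of pi k] by (simp add: mult.commute)
      \<comment> \<open>This keeps \<open>\<psi>\<close> inside the parameter interval of the
        curve.\<close>
      have "k + 1 \<le> 2 * d"
        using k I(1) by auto
      then have "pi * (k + 1) \<le> pi * (2 * d)"
        by (intro mult_left_mono) (auto simp flip: of_nat_Suc)
      with \<phi> have "\<psi> \<in> {0..2 * real d * pi}"
        by (auto simp: \<psi>_def algebra_simps)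
      moreover have "cis (- \<psi>) * (cis \<phi>)\<^sup>2 = cis \<psi>"
      proof -
        have "cis (- \<psi>) * (cis \<phi>)\<^sup>2 = cis \<psi> * cis (- (pi * k)) * cis (- (pi * k))"
          by (simp add: \<psi>_def power2_eq_square cis_mult)
        also have "cis (- (pi * k)) = (-1) ^ k"
          using sgn by (metis cis_cnj complex_cnj_minus complex_cnj_one complex_cnj_power)
        finally show ?thesis
          by (simp flip: power_mult_distrib)
      qed
      ultimately show "poly2 G (line_point \<phi> k * y\<^sup>2) (line_point \<phi> k) = 0"
        using G_curve [of \<psi>] by (simp add: line_point_def y mult.assoc flip: \<psi>_def)
      \<comment> \<open>Each half turn reverses the direction, so the factor of
        \<open>line_poly\<close> vanishing at this point is that of the sign
        \<open>(-1) ^ k\<close>.\<close>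
      have *: "(-1) ^ k * y = cis \<psi>"
        by (simp add: y \<psi>_def cis_mult flip: sgn) (simp add: add.commute)
      have "line_point \<phi> k * cis \<psi> = radius \<psi>"
        by (simp add: line_point_def cis_mult flip: \<psi>_def)
      moreover have "cis \<psi> ^ n * (cis (n * \<psi>) + cis (- (n * \<psi>))) = y ^ (2 * n) + 1"
      proof -
        have "cis \<psi> ^ n * (cis (n * \<psi>) + cis (- (n * \<psi>))) = cis \<psi> ^ (2 * n) + 1"
          by (simp add: Complex.DeMoivre distrib_left cis_mult mult_ac)
        also have "cis \<psi> ^ (2 * n) = y ^ (2 * n)"
          unfolding * [symmetric] power_mult_distrib by (simp flip: power_mult)
        finally show ?thesis .
      qed
      ultimately show "poly (line_poly y 1) (line_point \<phi> k) = 0"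
        unfolding line_poly_def poly_prod prod_zero_iff [OF finite_J]
        using J(2) [OF k]
        by (intro bexI [of _ "(-1) ^ k"]) (simp_all add: poly_pcompose * poly_T_radius)
    qed
    ultimately show "\<exists>V. card J * d \<le> card V \<and>
        (\<forall>v\<in>V. poly2 G (v * y\<^sup>2) v = 0 \<and> poly (line_poly y 1) v = 0)"
      by (intro exI [of _ "line_point \<phi> ` I"]) auto
  qed
  then obtain Q where Q: "G = F * Q"
    by blast
  have "polyfun2 (\<lambda>x y. poly2 Q (x + \<i> * y) (x - \<i> * y))"
    by (intro polyfun2_intros)
  then obtain Q' where Q': "\<And>x y. poly2 Q' x y = poly2 Q (x + \<i> * y) (x - \<i> * y)"
    unfolding polyfun2_def by blast
  have "H = E * Q'"
  proof (rule poly2_eqI)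
    fix x y :: complex
    have "poly2 H x y = poly2 G (x + \<i> * y) (x - \<i> * y)"
      by (simp add: G)
    then show "poly2 H x y = poly2 (E * Q') x y"
      by (simp add: Q E Q')
  qed
  then show "E dvd H"
    by simp
qed

end

text \<open>In the first case \<open>r^n C_d(r)\<close>, with the Chebyshev polynomial
  \<open>C_d\<close>, is even in \<open>r\<close>; the sign \<open>-1\<close> would only repeat the
  factor and make the product a square.\<close>

definition curve_index :: "nat \<Rightarrow> nat \<Rightarrow> real \<Rightarrow> complex set" where
  "curve_index n d a = (if a = 0 \<and> odd (n * d) then {1} else {1, -1})"

lemma cyclic_harmonic_equation_exists:
  assumes "n > 0" "d > 0" "coprime n d"
  obtains T F I where "cyclic_harmonic_equation n d (curve_index n d a) T F a I"
proof -
  define simple where "simple \<longleftrightarrow> a = 0 \<and> odd (n * d)"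
  let ?J = "curve_index n d a"
  define T where "T = smult 2 (pcompose (cheb d) [:- of_real a, 1:])"
  \<comment> \<open>The even numbers below \<open>2 * d\<close> in the simple case, all numbers
    below \<open>2 * d\<close> otherwise.\<close>
  define I where "I = (\<lambda>i. (if simple then 2 else 1) * i) ` {..<card ?J * d}"
  have degree_T: "degree T = d"
    by (simp add: T_def degree_pcompose degree_cheb)
  have J_eq: "?J = (if simple then {1} else {1, -1})"
    by (simp add: curve_index_def simple_def)
  then have card_J: "card ?J = (if simple then 1 else 2)"
    by simp
  obtain Q R where QR: "\<And>x. x ^ n * poly T x = poly Q (x\<^sup>2) + x * poly R (x\<^sup>2)"
    using even_odd_parts [of "monom 1 n * T"] by (auto simp: poly_monom)
  have "\<exists>F. \<forall>p q. poly2 F (p\<^sup>2) (q\<^sup>2) =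
      (\<Prod>e\<in>?J. (e * p * q) ^ n * poly T (e * p * q) - (p ^ (2 * n) + q ^ (2 * n)))"
  proof (cases simple)
    case True
    have "T = smult 2 (cheb d)"
      using True by (simp add: T_def simple_def pcompose_idR)
    \<comment> \<open>\<open>cheb d\<close> has the parity of \<open>d\<close>, and
      \<open>n + d\<close> is even.\<close>
    then have "(- x) ^ n * poly T (- x) = x ^ n * poly T x" for x
      using True by (simp add: simple_def poly_cheb_minus)
    then have odd_part: "x * poly R (x\<^sup>2) = 0" for x
      using QR [of x] QR [of "- x"] by (simp add: algebra_simps)
    have "polyfun2 (\<lambda>u v. poly Q (u * v) - (u ^ n + v ^ n))"
      by (intro polyfun2_intros)
    then obtain F where F: "\<And>u v. poly2 F u v = poly Q (u * v) - (u ^ n + v ^ n)"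
      unfolding polyfun2_def by blast
    have "?J = {1}"
      using True by (simp add: J_eq)
    then have "poly2 F (p\<^sup>2) (q\<^sup>2) =
        (\<Prod>e\<in>?J. (e * p * q) ^ n * poly T (e * p * q) - (p ^ (2 * n) + q ^ (2 * n)))" for p q
      using QR [of "p * q"] odd_part [of "p * q"] by (simp add: F power_mult_distrib power_mult)
    then show ?thesis
      by blast
  next
    case False
    \<comment> \<open>The product of the factors \<open>Q - s + \<rho> R\<close> and
      \<open>Q - s - \<rho> R\<close>, where \<open>s = u^n + v^n\<close> and
      \<open>\<rho>^2 = u * v\<close>.\<close>
    have "polyfun2 (\<lambda>u v. (poly Q (u * v) - (u ^ n + v ^ n))\<^sup>2 - u * v * (poly R (u * v))\<^sup>2)"
      by (intro polyfun2_intros)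
    then obtain F where F: "\<And>u v. poly2 F u v =
        (poly Q (u * v) - (u ^ n + v ^ n))\<^sup>2 - u * v * (poly R (u * v))\<^sup>2"
      unfolding polyfun2_def by blast
    have J: "?J = {1, -1}"
      using False by (simp add: J_eq)
    have "poly2 F (p\<^sup>2) (q\<^sup>2) =
        (\<Prod>e\<in>?J. (e * p * q) ^ n * poly T (e * p * q) - (p ^ (2 * n) + q ^ (2 * n)))" for p q
    proof -
      define \<rho> where "\<rho> = p * q"
      have e: "e * p * q = e * \<rho>" for e
        by (simp add: \<rho>_def)
      have \<rho>: "p\<^sup>2 * q\<^sup>2 = \<rho>\<^sup>2"
        by (simp add: \<rho>_def power_mult_distrib)
      have "(\<Prod>e\<in>?J. (e * p * q) ^ n * poly T (e * p * q) - (p ^ (2 * n) + q ^ (2 * n))) =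
          (\<rho> ^ n * poly T \<rho> - (p ^ (2 * n) + q ^ (2 * n))) *
          ((- \<rho>) ^ n * poly T (- \<rho>) - (p ^ (2 * n) + q ^ (2 * n)))"
        unfolding J e by simp
      then show ?thesis
        unfolding QR F \<rho> by (simp add: power_mult power2_eq_square algebra_simps)
    qed
    then show ?thesis
      by blast
  qed
  then obtain F where F: "\<And>p q. poly2 F (p\<^sup>2) (q\<^sup>2) =
      (\<Prod>e\<in>?J. (e * p * q) ^ n * poly T (e * p * q) - (p ^ (2 * n) + q ^ (2 * n)))"
    by blast
  have "cyclic_harmonic_equation n d ?J T F a I"
  proof
    show "n > 0" "d > 0" "coprime n d"
      by fact+
    show "finite ?J" "?J \<noteq> {}" "0 \<notin> ?J" "1 \<in> ?J"
      by (auto simp: curve_index_def)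
    show "even (card ?J * (n + d))"
      by (auto simp: card_J simple_def)
    show "degree T = d" "\<And>p q. poly2 F (p\<^sup>2) (q\<^sup>2) =
        (\<Prod>e\<in>?J. (e * p * q) ^ n * poly T (e * p * q) - (p ^ (2 * n) + q ^ (2 * n)))"
      by fact+
    show "(-1) ^ k \<in> ?J" if "k \<in> I" for k
      using that by (auto simp: J_eq I_def minus_one_power_iff)
    show "I \<subseteq> {..<2 * d}"
      by (auto simp: I_def card_J)
    show "card I = card ?J * d"
      unfolding I_def by (subst card_image) (auto simp: inj_on_def)
    show "even k" if "a = 0" "odd (n * d)" "k \<in> I" for k
      using that by (auto simp: I_def simple_def)
    show "poly T (of_real (cos (real n / real d * \<phi>) + a)) = cis (n * \<phi>) + cis (- (n * \<phi>))" for \<phi> :: real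
    proof -
      have "poly T (of_real (cos (real n / real d * \<phi>) + a)) =
          2 * of_real (cos (real d * (real n / real d * \<phi>)))"
        by (simp add: T_def poly_pcompose poly_cheb_cos)
      then show ?thesis
        using assms(2) by (simp add: complex_eq_iff)
    qed
  qed
  with that show ?thesis
    by blast
qed

theorem theorem1:
  fixes n d :: nat and a :: real
  assumes "n > 0" and "d > 0" and "coprime n d" and "a \<ge> 0"
  shows "(\<exists>F. implicit_equation (cyclic_harmonic n d a) F) \<and>
    (\<forall>F. implicit_equation (cyclic_harmonic n d a) F \<longrightarrow>
      (a = 0 \<and> odd (n * d) \<longrightarrow>
        (d < n \<longrightarrow>
          total_degree F = n + d \<and>
          point_multiplicity F (1, 0, 0) = n \<and>
          point_multiplicity F (0, 1, \<i>) = d \<and>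
          point_multiplicity F (0, 1, - \<i>) = d) \<and>
        (d > n \<longrightarrow>
          total_degree F = n + d \<and>
          point_multiplicity F (1, 0, 0) = n \<and>
          point_multiplicity F (0, 1, \<i>) = (n + d) div 2 \<and>
          point_multiplicity F (0, 1, - \<i>) = (n + d) div 2)) \<and>
      (a \<noteq> 0 \<or> even (n * d) \<longrightarrow>
        (d < n \<longrightarrow>
          total_degree F = 2 * (n + d) \<and>
          point_multiplicity F (1, 0, 0) = 2 * n \<and>
          point_multiplicity F (0, 1, \<i>) = 2 * d \<and>
          point_multiplicity F (0, 1, - \<i>) = 2 * d) \<and>
        (d > n \<longrightarrow>
          total_degree F = 2 * (n + d) \<and>
          point_multiplicity F (1, 0, 0) = 2 * n \<and>
          point_multiplicity F (0, 1, \<i>) = n + d \<and>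
          point_multiplicity F (0, 1, - \<i>) = n + d)))"
proof -
  obtain T E0 I where "cyclic_harmonic_equation n d (curve_index n d a) T E0 a I"
    using cyclic_harmonic_equation_exists assms(1-3) by blast
  then interpret cyclic_harmonic_equation n d "curve_index n d a" T E0 a I .
  have "polyfun2 (\<lambda>x y. poly2 E0 (x + \<i> * y) (x - \<i> * y))"
    by (intro polyfun2_intros)
  then obtain E where E: "\<And>x y. poly2 E x y = poly2 E0 (x + \<i> * y) (x - \<i> * y)"
    unfolding polyfun2_def by blast
  have impl: "implicit_equation (cyclic_harmonic n d a) E"
    by (rule implicit_equation_cyclic_harmonic) (rule E)
  define m where "m = card (curve_index n d a)"
  have m: "m = (if a = 0 \<and> odd (n * d) then 1 else 2)"
    by (simp add: m_def curve_index_def)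
  have *: "total_degree F = m * (n + d) \<and> point_multiplicity F (1, 0, 0) = m * n \<and>
      (n \<noteq> d \<longrightarrow> c = \<i> \<or> c = - \<i> \<longrightarrow>
        point_multiplicity F (0, 1, c) = m * (n + d) - m * max (2 * n) (n + d) div 2)"
    if F: "implicit_equation (cyclic_harmonic n d a) F" for F c
  proof -
    obtain b where b: "b \<noteq> 0" "F = smult [:b:] E"
      using implicit_equation_unique [OF impl F] by blast
    \<comment> \<open>Either \<open>m = 2\<close>, or \<open>n\<close> and \<open>d\<close> are both
      odd; hence the division by 2 is exact.\<close>
    have "even (m * max (2 * n) (n + d))"
      by (auto simp: m max_def)
    then have "2 * (m * max (2 * n) (n + d) div 2) = m * max (2 * n) (n + d)"
      by simp
    with b show ?thesis
      using total_degree_E [OF E] multiplicity_origin_E [OF E] multiplicity_absolute_E [OF E, of c]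
      by (simp add: total_degree_smult point_multiplicity_smult m_def mult.commute [of n])
  qed
  have "even (m * (n + d))"
    by (auto simp: m)
  then obtain w where w: "m * (n + d) = 2 * w"
    by blast
  \<comment> \<open>The maximum is \<open>2 * n\<close> for \<open>d < n\<close> and
    \<open>n + d\<close> for \<open>n < d\<close>, which separates the two cases of the
    theorem.\<close>
  have absolute: "d < n \<Longrightarrow> m * (n + d) - m * max (2 * n) (n + d) div 2 = m * d"
    "n < d \<Longrightarrow> m * (n + d) - m * max (2 * n) (n + d) div 2 = m * (n + d) div 2"
    by (simp add: max_def distrib_left) (simp add: max_def w)
  from impl have ex: "\<exists>F. implicit_equation (cyclic_harmonic n d a) F"
    by blast
  show ?thesis
  proof (intro conjI [OF ex] allI impI)
    fix F assume "implicit_equation (cyclic_harmonic n d a) F"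
    note F = * [OF this, of \<i>] * [OF this, of "- \<i>"]
    show "(a = 0 \<and> odd (n * d) \<longrightarrow>
        (d < n \<longrightarrow>
          total_degree F = n + d \<and>
          point_multiplicity F (1, 0, 0) = n \<and>
          point_multiplicity F (0, 1, \<i>) = d \<and>
          point_multiplicity F (0, 1, - \<i>) = d) \<and>
        (d > n \<longrightarrow>
          total_degree F = n + d \<and>
          point_multiplicity F (1, 0, 0) = n \<and>
          point_multiplicity F (0, 1, \<i>) = (n + d) div 2 \<and>
          point_multiplicity F (0, 1, - \<i>) = (n + d) div 2)) \<and>
      (a \<noteq> 0 \<or> even (n * d) \<longrightarrow>
        (d < n \<longrightarrow>
          total_degree F = 2 * (n + d) \<and>
          point_multiplicity F (1, 0, 0) = 2 * n \<and>
          point_multiplicity F (0, 1, \<i>) = 2 * d \<and>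
          point_multiplicity F (0, 1, - \<i>) = 2 * d) \<and>
        (d > n \<longrightarrow>
          total_degree F = 2 * (n + d) \<and>
          point_multiplicity F (1, 0, 0) = 2 * n \<and>
          point_multiplicity F (0, 1, \<i>) = n + d \<and>
          point_multiplicity F (0, 1, - \<i>) = n + d))"
    proof (cases "a = 0 \<and> odd (n * d)")
      case True
      then have "m = 1"
        by (simp add: m)
      with True F absolute show ?thesis
        by (cases n d rule: linorder_cases) simp_all
    next
      case False
      then have "m = 2"
        by (simp only: m if_False)
      with False F absolute show ?thesis
        by (cases n d rule: linorder_cases) simp_all
    qed
  qed
qed

end
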